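(* Let $\Phi=(A;\{E_i\}_{i=0}^d;A^*;\{E^*_i\}_{i=0}^d)$ be a Leonard system on $V$, with $d\ge 3$ and with $\mathbb F$ algebraically closed. Assume that $\Phi$ has one of the following types: dual $q$-Hahn, quantum $q$-Krawtchouk, $q$-Krawtchouk, affine $q$-Krawtchouk, dual Hahn, Orphan. Then the zero diagonal space satisfies ${\mathcal Z}(\Phi)=0$.
   Context: Let $\mathbb F$ be an algebraically closed field and $V$ a vector space over $\mathbb F$ of dimension $d+1$ with $d\ge 3$. "Scalar" means element of $\mathbb F$; integers appearing in formulas are read in $\mathbb F$. A tridiagonal matrix is irreducible if all entries on its subdiagonal and superdiagonal are nonzero. A Leonard pair on $V$ is an ordered pair $A,A^*\in \mathrm{End}(V)$ such that (i) there is a basis of $V$ with respect to which $A$ is irreducible tridiagonal and $A^*$ is diagonal; (ii) there is a basis of $V$ with respect to which $A^*$ is irreducible tridiagonal and $A$ is diagonal. Then $A,A^*$ are multiplicity-free (diagonalizable with one-dimensional eigenspaces). The primitive idempotent of $A$ for an eigenvalue $\theta$ is the projection onto the $\theta$-eigenspace along the sum of the other eigenspaces. An ordering $\{\theta_i\}_{i=0}^d$ of the eigenvalues of $A$ (and the corresponding ordering $\{E_i\}_{i=0}^d$ of primitive idempotents) is standard if corresponding eigenvectors $v_0,\dots,v_d$, in this order, form a basis as in (ii). Standard orderings for $A^*$ are defined similarly using (i). A Leonard system on $V$ is a sequence $\Phi=(A;\{E_i\}_{i=0}^d;A^*;\{E^*_i\}_{i=0}^d)$ where $A,A^*$ is a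 Leonard pair on $V$ and $\{E_i\}$, $\{E^*_i\}$ are standard orderings of the primitive idempotents of $A$, $A^*$. Parameter array: $\theta_i$ (resp. $\theta^*_i$) is the eigenvalue of $A$ (resp. $A^*$) for $E_i$ (resp. $E^*_i$). For $0\ne u\in E^*_0V$ the vectors $u_i=(A-\theta_0I)\cdots(A-\theta_{i-1}I)u$ $(0\le i\le d)$ form a basis of $V$, and $A^*u_0=\theta^*_0u_0$, $A^*u_i=\theta^*_iu_i+\varphi_iu_{i-1}$ $(1\le i\le d)$ for nonzero scalars $\varphi_i$; $\{\varphi_i\}_{i=1}^d$ is the first split sequence of $\Phi$. The second split sequence $\{\phi_i\}_{i=1}^d$ is the first split sequence of the Leonard system $(A;\{E_{d-i}\}_{i=0}^d;A^*;\{E^*_i\}_{i=0}^d)$. Zero diagonal space: ${\mathcal Z}(\Phi)$ is the set of $X\in\mathrm{Span}\{I,A^*,A,AA^*\}$ such that $E^*_iXE^*_i=0$ for $0\le i\le d$. Types (formulas for $\theta_i,\theta^*_i$ hold for $0\le i\le d$, those for $\varphi_i,\phi_i$ for $1\le i\le d$): Dual $q$-Hahn type: there exist nonzero scalars $q,h,h^*,s,r$ with none of $q^i,rq^i,sq^i/r$ equal to $1$ for $1\le i\le d$; $sq^i\ne1$ for $2\le i\le 2d$; $\theta_i=\theta_0+h(1-q^i)(1-sq^{i+1})q^{-i}$, $\theta^*_i=\theta^*_0+h^*(1-q^i)q^{-i}$; $\varphi_i=hh^*q^{1-2i}(1-q^i)(1-q^{i-d-1})(1-rq^i)$, $\phi_i=hh^*q^{d+2-2i}(1-q^i)(1-q^{i-d-1})(s-rq^{i-d-1})$.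 Quantum $q$-Krawtchouk type: there exist nonzero scalars $q,h^*,s,r$ with $q^i\ne1$, $sq^i/r\ne1$ for $1\le i\le d$; $\theta_i=\theta_0-sq(1-q^i)$, $\theta^*_i=\theta^*_0+h^*(1-q^i)q^{-i}$; $\varphi_i=-rh^*q^{1-i}(1-q^i)(1-q^{i-d-1})$, $\phi_i=h^*q^{d+2-2i}(1-q^i)(1-q^{i-d-1})(s-rq^{i-d-1})$. $q$-Krawtchouk type: there exist nonzero scalars $q,h,h^*,s^*$ with $q^i\ne1$ for $1\le i\le d$; $s^*q^i\ne1$ for $2\le i\le 2d$; $\theta_i=\theta_0+h(1-q^i)q^{-i}$, $\theta^*_i=\theta^*_0+h^*(1-q^i)(1-s^*q^{i+1})q^{-i}$; $\varphi_i=hh^*q^{1-2i}(1-q^i)(1-q^{i-d-1})$, $\phi_i=hh^*s^*q(1-q^i)(1-q^{i-d-1})$. Affine $q$-Krawtchouk type: there exist nonzero scalars $q,h,h^*,r$ with $q^i\ne1$, $rq^i\ne1$ for $1\le i\le d$; $\theta_i=\theta_0+h(1-q^i)q^{-i}$, $\theta^*_i=\theta^*_0+h^*(1-q^i)q^{-i}$; $\varphi_i=hh^*q^{1-2i}(1-q^i)(1-q^{i-d-1})(1-rq^i)$, $\phi_i=-hh^*rq^{1-i}(1-q^i)(1-q^{i-d-1})$. Dual Hahn type: there exist scalars $h,s,s^*,r$ with $h,s^*$ nonzero; $\mathrm{char}\,\mathbb F$ is $0$ or a prime greater than $d$; neither of $r,\,s-r$ equals $-i$ for $1\le i\le d$;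 $s\ne-i$ for $2\le i\le 2d$; $\theta_i=\theta_0+hi(i+1+s)$, $\theta^*_i=\theta^*_0+s^*i$; $\varphi_i=hs^*i(i-d-1)(i+r)$, $\phi_i=hs^*i(i-d-1)(i+r-s-d-1)$. Orphan type: $d=3$, $\mathrm{char}\,\mathbb F=2$, and there exist nonzero scalars $h,h^*,s,s^*,r$ with $s\ne1$, $s^*\ne1$; $r$ equal to none of $s+s^*$, $s(1+s^* )$, $s^*(1+s)$; $\theta_1=\theta_0+h(s+1)$, $\theta_2=\theta_0+h$, $\theta_3=\theta_0+hs$, $\theta^*_1=\theta^*_0+h^*(s^*+1)$, $\theta^*_2=\theta^*_0+h^*$, $\theta^*_3=\theta^*_0+h^*s^*$; $\varphi_1=hh^*r$, $\varphi_2=hh^*$, $\varphi_3=hh^*(r+s+s^* )$, $\phi_1=hh^*(r+s+ss^* )$, $\phi_2=hh^*$, $\phi_3=hh^*(r+s^*+ss^* )$. *)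

theory Defs
  imports
    "HOL-Computational_Algebra.Computational_Algebra"
    "HOL-Library.Function_Algebras"
begin

(* The vector space V is the whole type 'v, with scalar multiplication "scale".  Sequences indexed
   by 0..d (or 1..d) are functions on nat; only their values at these indices matter. *)

definition ordered_basis ::
  "('a::field \<Rightarrow> 'v::ab_group_add \<Rightarrow> 'v) \<Rightarrow> nat \<Rightarrow> (nat \<Rightarrow> 'v) \<Rightarrow> bool" where
  "ordered_basis scale d v \<longleftrightarrow>
     inj_on v {..d} \<and> \<not> module.dependent scale (v ` {..d}) \<and>
     module.span scale (v ` {..d}) = UNIV"

(* Column convention: the j-th column of M holds the coordinates of A (v j). *)
definition matrix_wrt ::
  "('a::field \<Rightarrow> 'v::ab_group_add \<Rightarrow> 'v) \<Rightarrow> nat \<Rightarrow> (nat \<Rightarrow> 'v) \<Rightarrow> ('v \<Rightarrow> 'v)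
     \<Rightarrow> (nat \<Rightarrow> nat \<Rightarrow> 'a) \<Rightarrow> bool" where
  "matrix_wrt scale d v A M \<longleftrightarrow> (\<forall>j\<le>d. A (v j) = (\<Sum>i\<le>d. scale (M i j) (v i)))"

definition diagonal :: "nat \<Rightarrow> (nat \<Rightarrow> nat \<Rightarrow> 'a::field) \<Rightarrow> bool" where
  "diagonal d M \<longleftrightarrow> (\<forall>i\<le>d. \<forall>j\<le>d. i \<noteq> j \<longrightarrow> M i j = 0)"

definition tridiagonal :: "nat \<Rightarrow> (nat \<Rightarrow> nat \<Rightarrow> 'a::field) \<Rightarrow> bool" where
  "tridiagonal d M \<longleftrightarrow> (\<forall>i\<le>d. \<forall>j\<le>d. i > Suc j \<or> j > Suc i \<longrightarrow> M i j = 0)"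

definition irreducible_tridiagonal :: "nat \<Rightarrow> (nat \<Rightarrow> nat \<Rightarrow> 'a::field) \<Rightarrow> bool" where
  "irreducible_tridiagonal d M \<longleftrightarrow>
     tridiagonal d M \<and> (\<forall>i<d. M (Suc i) i \<noteq> 0 \<and> M i (Suc i) \<noteq> 0)"

definition tridiagonal_diagonal_basis ::
  "('a::field \<Rightarrow> 'v::ab_group_add \<Rightarrow> 'v) \<Rightarrow> nat \<Rightarrow> ('v \<Rightarrow> 'v) \<Rightarrow> ('v \<Rightarrow> 'v) \<Rightarrow> (nat \<Rightarrow> 'v) \<Rightarrow> bool"
where
  "tridiagonal_diagonal_basis scale d A B v \<longleftrightarrow>
     ordered_basis scale d v \<and>
     (\<exists>M. matrix_wrt scale d v A M \<and> irreducible_tridiagonal d M) \<and>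
     (\<exists>M. matrix_wrt scale d v B M \<and> diagonal d M)"

definition leonard_pair ::
  "('a::field \<Rightarrow> 'v::ab_group_add \<Rightarrow> 'v) \<Rightarrow> nat \<Rightarrow> ('v \<Rightarrow> 'v) \<Rightarrow> ('v \<Rightarrow> 'v) \<Rightarrow> bool" where
  "leonard_pair scale d A As \<longleftrightarrow>
     Vector_Spaces.linear scale scale A \<and> Vector_Spaces.linear scale scale As \<and>
     (\<exists>v. tridiagonal_diagonal_basis scale d A As v) \<and>
     (\<exists>v. tridiagonal_diagonal_basis scale d As A v)"

definition eigenspace :: "('a::field \<Rightarrow> 'v::ab_group_add \<Rightarrow> 'v) \<Rightarrow> ('v \<Rightarrow> 'v) \<Rightarrow> 'a \<Rightarrow> 'v set" where
  "eigenspace scale A t = {v. A v = scale t v}"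

definition eigenvalue :: "('a::field \<Rightarrow> 'v::ab_group_add \<Rightarrow> 'v) \<Rightarrow> ('v \<Rightarrow> 'v) \<Rightarrow> 'a \<Rightarrow> bool" where
  "eigenvalue scale A t \<longleftrightarrow> (\<exists>v. v \<noteq> 0 \<and> A v = scale t v)"

definition projection_along ::
  "('a::field \<Rightarrow> 'v::ab_group_add \<Rightarrow> 'v) \<Rightarrow> 'v set \<Rightarrow> 'v set \<Rightarrow> ('v \<Rightarrow> 'v) \<Rightarrow> bool" where
  "projection_along scale W U P \<longleftrightarrow>
     Vector_Spaces.linear scale scale P \<and> range P = W \<and> (\<forall>w\<in>W. P w = w) \<and> {v. P v = 0} = U"

definition primitive_idempotent ::
  "('a::field \<Rightarrow> 'v::ab_group_add \<Rightarrow> 'v) \<Rightarrow> ('v \<Rightarrow> 'v) \<Rightarrow> 'a \<Rightarrow> ('v \<Rightarrow> 'v) \<Rightarrow> bool" where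
  "primitive_idempotent scale A t P \<longleftrightarrow>
     eigenvalue scale A t \<and>
     projection_along scale (eigenspace scale A t)
       (module.span scale (\<Union>u\<in>- {t}. eigenspace scale A u)) P"

definition standard_ordering ::
  "('a::field \<Rightarrow> 'v::ab_group_add \<Rightarrow> 'v) \<Rightarrow> nat \<Rightarrow> ('v \<Rightarrow> 'v) \<Rightarrow> ('v \<Rightarrow> 'v) \<Rightarrow> (nat \<Rightarrow> 'a) \<Rightarrow> bool"
where
  "standard_ordering scale d A B \<theta> \<longleftrightarrow>
     bij_betw \<theta> {..d} {t. eigenvalue scale A t} \<and>
     (\<exists>v. (\<forall>i\<le>d. v i \<noteq> 0 \<and> A (v i) = scale (\<theta> i) (v i)) \<and>
          tridiagonal_diagonal_basis scale d B A v)"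

definition eigenvalue_sequence ::
  "('a::field \<Rightarrow> 'v::ab_group_add \<Rightarrow> 'v) \<Rightarrow> nat \<Rightarrow> ('v \<Rightarrow> 'v) \<Rightarrow> (nat \<Rightarrow> 'v \<Rightarrow> 'v) \<Rightarrow> (nat \<Rightarrow> 'a) \<Rightarrow> bool"
where
  "eigenvalue_sequence scale d A E \<theta> \<longleftrightarrow> (\<forall>i\<le>d. primitive_idempotent scale A (\<theta> i) (E i))"

definition leonard_system ::
  "('a::field \<Rightarrow> 'v::ab_group_add \<Rightarrow> 'v) \<Rightarrow> nat \<Rightarrow>
     ('v \<Rightarrow> 'v) \<Rightarrow> (nat \<Rightarrow> 'v \<Rightarrow> 'v) \<Rightarrow> ('v \<Rightarrow> 'v) \<Rightarrow> (nat \<Rightarrow> 'v \<Rightarrow> 'v) \<Rightarrow> bool" where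
  "leonard_system scale d A E As Es \<longleftrightarrow>
     leonard_pair scale d A As \<and>
     (\<exists>\<theta>. standard_ordering scale d A As \<theta> \<and> eigenvalue_sequence scale d A E \<theta>) \<and>
     (\<exists>\<theta>s. standard_ordering scale d As A \<theta>s \<and> eigenvalue_sequence scale d As Es \<theta>s)"

(* split_vector scale A \<theta> u i = (A - \<theta> 0 I) ... (A - \<theta> (i-1) I) u; the factors commute. *)
primrec split_vector ::
  "('a::field \<Rightarrow> 'v::ab_group_add \<Rightarrow> 'v) \<Rightarrow> ('v \<Rightarrow> 'v) \<Rightarrow> (nat \<Rightarrow> 'a) \<Rightarrow> 'v \<Rightarrow> nat \<Rightarrow> 'v" where
  "split_vector scale A \<theta> u 0 = u"
| "split_vector scale A \<theta> u (Suc i) =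
     A (split_vector scale A \<theta> u i) - scale (\<theta> i) (split_vector scale A \<theta> u i)"

(* For a Leonard system the split vectors form a basis, so \<phi> 1, ..., \<phi> d are determined by these
   equations, and they are nonzero; neither fact is made part of the definition. *)
definition first_split_sequence ::
  "('a::field \<Rightarrow> 'v::ab_group_add \<Rightarrow> 'v) \<Rightarrow> nat \<Rightarrow>
     ('v \<Rightarrow> 'v) \<Rightarrow> (nat \<Rightarrow> 'v \<Rightarrow> 'v) \<Rightarrow> ('v \<Rightarrow> 'v) \<Rightarrow> (nat \<Rightarrow> 'v \<Rightarrow> 'v) \<Rightarrow> (nat \<Rightarrow> 'a) \<Rightarrow> bool" where
  "first_split_sequence scale d A E As Es \<phi> \<longleftrightarrow>
     (\<exists>\<theta> \<theta>s. eigenvalue_sequence scale d A E \<theta> \<and> eigenvalue_sequence scale d As Es \<theta>s \<and>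
        (\<forall>u \<in> range (Es 0). u \<noteq> 0 \<longrightarrow>
           As (split_vector scale A \<theta> u 0) = scale (\<theta>s 0) (split_vector scale A \<theta> u 0) \<and>
           (\<forall>i\<in>{1..d}. As (split_vector scale A \<theta> u i) =
              scale (\<theta>s i) (split_vector scale A \<theta> u i) +
              scale (\<phi> i) (split_vector scale A \<theta> u (i - 1)))))"

definition second_split_sequence ::
  "('a::field \<Rightarrow> 'v::ab_group_add \<Rightarrow> 'v) \<Rightarrow> nat \<Rightarrow>
     ('v \<Rightarrow> 'v) \<Rightarrow> (nat \<Rightarrow> 'v \<Rightarrow> 'v) \<Rightarrow> ('v \<Rightarrow> 'v) \<Rightarrow> (nat \<Rightarrow> 'v \<Rightarrow> 'v) \<Rightarrow> (nat \<Rightarrow> 'a) \<Rightarrow> bool" where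
  "second_split_sequence scale d A E As Es \<psi> \<longleftrightarrow>
     first_split_sequence scale d A (\<lambda>i. E (d - i)) As Es \<psi>"

definition parameter_array ::
  "('a::field \<Rightarrow> 'v::ab_group_add \<Rightarrow> 'v) \<Rightarrow> nat \<Rightarrow>
     ('v \<Rightarrow> 'v) \<Rightarrow> (nat \<Rightarrow> 'v \<Rightarrow> 'v) \<Rightarrow> ('v \<Rightarrow> 'v) \<Rightarrow> (nat \<Rightarrow> 'v \<Rightarrow> 'v) \<Rightarrow>
     (nat \<Rightarrow> 'a) \<Rightarrow> (nat \<Rightarrow> 'a) \<Rightarrow> (nat \<Rightarrow> 'a) \<Rightarrow> (nat \<Rightarrow> 'a) \<Rightarrow> bool" where
  "parameter_array scale d A E As Es \<theta> \<theta>s \<phi> \<psi> \<longleftrightarrow>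
     eigenvalue_sequence scale d A E \<theta> \<and>
     eigenvalue_sequence scale d As Es \<theta>s \<and>
     first_split_sequence scale d A E As Es \<phi> \<and>
     second_split_sequence scale d A E As Es \<psi>"

(* The span is taken in the space of maps 'v \<Rightarrow> 'v with pointwise operations. *)
definition zero_diagonal_space ::
  "('a::field \<Rightarrow> 'v::ab_group_add \<Rightarrow> 'v) \<Rightarrow> nat \<Rightarrow> ('v \<Rightarrow> 'v) \<Rightarrow> ('v \<Rightarrow> 'v) \<Rightarrow> (nat \<Rightarrow> 'v \<Rightarrow> 'v)
     \<Rightarrow> ('v \<Rightarrow> 'v) set" where
  "zero_diagonal_space scale d A As Es =
     {X \<in> module.span (\<lambda>c (F :: 'v \<Rightarrow> 'v) x. scale c (F x)) {id, As, A, A \<circ> As}.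
        \<forall>i\<le>d. Es i \<circ> X \<circ> Es i = (\<lambda>_. 0)}"

(* In the types below the parameters hs, ss stand for h^*, s^*; "\<phi>" and "\<psi>" are the first and the
   second split sequence. *)

definition dual_q_Hahn ::
  "nat \<Rightarrow> (nat \<Rightarrow> 'a::field) \<Rightarrow> (nat \<Rightarrow> 'a) \<Rightarrow> (nat \<Rightarrow> 'a) \<Rightarrow> (nat \<Rightarrow> 'a) \<Rightarrow> bool" where
  "dual_q_Hahn d \<theta> \<theta>s \<phi> \<psi> \<longleftrightarrow>
     (\<exists>q h hs s r. q \<noteq> 0 \<and> h \<noteq> 0 \<and> hs \<noteq> 0 \<and> s \<noteq> 0 \<and> r \<noteq> 0 \<and>
        (\<forall>i\<in>{1..d}. q ^ i \<noteq> 1 \<and> r * q ^ i \<noteq> 1 \<and> s * q ^ i / r \<noteq> 1) \<and>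
        (\<forall>i\<in>{2..2*d}. s * q ^ i \<noteq> 1) \<and>
        (\<forall>i\<le>d. \<theta> i = \<theta> 0 + h * (1 - q ^ i) * (1 - s * q ^ (i + 1)) * q powi (- int i) \<and>
               \<theta>s i = \<theta>s 0 + hs * (1 - q ^ i) * q powi (- int i)) \<and>
        (\<forall>i\<in>{1..d}.
           \<phi> i = h * hs * q powi (1 - 2 * int i) * (1 - q ^ i) *
                 (1 - q powi (int i - int d - 1)) * (1 - r * q ^ i) \<and>
           \<psi> i = h * hs * q powi (int d + 2 - 2 * int i) * (1 - q ^ i) *
                 (1 - q powi (int i - int d - 1)) * (s - r * q powi (int i - int d - 1))))"

definition quantum_q_Krawtchouk ::
  "nat \<Rightarrow> (nat \<Rightarrow> 'a::field) \<Rightarrow> (nat \<Rightarrow> 'a) \<Rightarrow> (nat \<Rightarrow> 'a) \<Rightarrow> (nat \<Rightarrow> 'a) \<Rightarrow> bool" where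
  "quantum_q_Krawtchouk d \<theta> \<theta>s \<phi> \<psi> \<longleftrightarrow>
     (\<exists>q hs s r. q \<noteq> 0 \<and> hs \<noteq> 0 \<and> s \<noteq> 0 \<and> r \<noteq> 0 \<and>
        (\<forall>i\<in>{1..d}. q ^ i \<noteq> 1 \<and> s * q ^ i / r \<noteq> 1) \<and>
        (\<forall>i\<le>d. \<theta> i = \<theta> 0 - s * q * (1 - q ^ i) \<and>
               \<theta>s i = \<theta>s 0 + hs * (1 - q ^ i) * q powi (- int i)) \<and>
        (\<forall>i\<in>{1..d}.
           \<phi> i = - r * hs * q powi (1 - int i) * (1 - q ^ i) *
                 (1 - q powi (int i - int d - 1)) \<and>
           \<psi> i = hs * q powi (int d + 2 - 2 * int i) * (1 - q ^ i) *
                 (1 - q powi (int i - int d - 1)) * (s - r * q powi (int i - int d - 1))))"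

definition q_Krawtchouk ::
  "nat \<Rightarrow> (nat \<Rightarrow> 'a::field) \<Rightarrow> (nat \<Rightarrow> 'a) \<Rightarrow> (nat \<Rightarrow> 'a) \<Rightarrow> (nat \<Rightarrow> 'a) \<Rightarrow> bool" where
  "q_Krawtchouk d \<theta> \<theta>s \<phi> \<psi> \<longleftrightarrow>
     (\<exists>q h hs ss. q \<noteq> 0 \<and> h \<noteq> 0 \<and> hs \<noteq> 0 \<and> ss \<noteq> 0 \<and>
        (\<forall>i\<in>{1..d}. q ^ i \<noteq> 1) \<and>
        (\<forall>i\<in>{2..2*d}. ss * q ^ i \<noteq> 1) \<and>
        (\<forall>i\<le>d. \<theta> i = \<theta> 0 + h * (1 - q ^ i) * q powi (- int i) \<and>
               \<theta>s i = \<theta>s 0 + hs * (1 - q ^ i) * (1 - ss * q ^ (i + 1)) * q powi (- int i)) \<and>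
        (\<forall>i\<in>{1..d}.
           \<phi> i = h * hs * q powi (1 - 2 * int i) * (1 - q ^ i) *
                 (1 - q powi (int i - int d - 1)) \<and>
           \<psi> i = h * hs * ss * q * (1 - q ^ i) * (1 - q powi (int i - int d - 1))))"

definition affine_q_Krawtchouk ::
  "nat \<Rightarrow> (nat \<Rightarrow> 'a::field) \<Rightarrow> (nat \<Rightarrow> 'a) \<Rightarrow> (nat \<Rightarrow> 'a) \<Rightarrow> (nat \<Rightarrow> 'a) \<Rightarrow> bool" where
  "affine_q_Krawtchouk d \<theta> \<theta>s \<phi> \<psi> \<longleftrightarrow>
     (\<exists>q h hs r. q \<noteq> 0 \<and> h \<noteq> 0 \<and> hs \<noteq> 0 \<and> r \<noteq> 0 \<and>
        (\<forall>i\<in>{1..d}. q ^ i \<noteq> 1 \<and> r * q ^ i \<noteq> 1) \<and>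
        (\<forall>i\<le>d. \<theta> i = \<theta> 0 + h * (1 - q ^ i) * q powi (- int i) \<and>
               \<theta>s i = \<theta>s 0 + hs * (1 - q ^ i) * q powi (- int i)) \<and>
        (\<forall>i\<in>{1..d}.
           \<phi> i = h * hs * q powi (1 - 2 * int i) * (1 - q ^ i) *
                 (1 - q powi (int i - int d - 1)) * (1 - r * q ^ i) \<and>
           \<psi> i = - h * hs * r * q powi (1 - int i) * (1 - q ^ i) *
                 (1 - q powi (int i - int d - 1))))"

definition dual_Hahn ::
  "nat \<Rightarrow> (nat \<Rightarrow> 'a::field) \<Rightarrow> (nat \<Rightarrow> 'a) \<Rightarrow> (nat \<Rightarrow> 'a) \<Rightarrow> (nat \<Rightarrow> 'a) \<Rightarrow> bool" where
  "dual_Hahn d \<theta> \<theta>s \<phi> \<psi> \<longleftrightarrow>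
     (\<exists>h s ss r. h \<noteq> 0 \<and> ss \<noteq> 0 \<and>
        (CHAR('a) = 0 \<or> prime CHAR('a) \<and> CHAR('a) > d) \<and>
        (\<forall>i\<in>{1..d}. r \<noteq> - of_nat i \<and> s - r \<noteq> - of_nat i) \<and>
        (\<forall>i\<in>{2..2*d}. s \<noteq> - of_nat i) \<and>
        (\<forall>i\<le>d. \<theta> i = \<theta> 0 + h * of_nat i * (of_nat i + 1 + s) \<and>
               \<theta>s i = \<theta>s 0 + ss * of_nat i) \<and>
        (\<forall>i\<in>{1..d}.
           \<phi> i = h * ss * of_nat i * (of_nat i - of_nat d - 1) * (of_nat i + r) \<and>
           \<psi> i = h * ss * of_nat i * (of_nat i - of_nat d - 1) *
                 (of_nat i + r - s - of_nat d - 1)))"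

definition orphan ::
  "nat \<Rightarrow> (nat \<Rightarrow> 'a::field) \<Rightarrow> (nat \<Rightarrow> 'a) \<Rightarrow> (nat \<Rightarrow> 'a) \<Rightarrow> (nat \<Rightarrow> 'a) \<Rightarrow> bool" where
  "orphan d \<theta> \<theta>s \<phi> \<psi> \<longleftrightarrow>
     d = 3 \<and> CHAR('a) = 2 \<and>
     (\<exists>h hs s ss r. h \<noteq> 0 \<and> hs \<noteq> 0 \<and> s \<noteq> 0 \<and> ss \<noteq> 0 \<and> r \<noteq> 0 \<and> s \<noteq> 1 \<and> ss \<noteq> 1 \<and>
        r \<noteq> s + ss \<and> r \<noteq> s * (1 + ss) \<and> r \<noteq> ss * (1 + s) \<and>
        \<theta> 1 = \<theta> 0 + h * (s + 1) \<and> \<theta> 2 = \<theta> 0 + h \<and> \<theta> 3 = \<theta> 0 + h * s \<and>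
        \<theta>s 1 = \<theta>s 0 + hs * (ss + 1) \<and> \<theta>s 2 = \<theta>s 0 + hs \<and> \<theta>s 3 = \<theta>s 0 + hs * ss \<and>
        \<phi> 1 = h * hs * r \<and> \<phi> 2 = h * hs \<and> \<phi> 3 = h * hs * (r + s + ss) \<and>
        \<psi> 1 = h * hs * (r + s + s * ss) \<and> \<psi> 2 = h * hs \<and> \<psi> 3 = h * hs * (r + ss + s * ss))"

end

(* An element al I + be A^* + ga A + ep A A^* has zero diagonal iff
   al + be theta^*_i + (ga + ep theta^*_i) a_i = 0 for 0 <= i <= d, where a_i is the i-th diagonal
   entry of A in an eigenbasis of A^*, namely
   a_i = theta_i + phi_i / (theta^*_i - theta^*_(i-1)) + phi_(i+1) / (theta^*_i - theta^*_(i+1)).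
   So 1, theta^*_i, a_i, a_i theta^*_i have to be linearly independent as functions of i.
   For the dual q-Hahn, affine and quantum q-Krawtchouk types a_i is a quadratic polynomial in
   y = q^i, while theta^*_i is affine in 1/y; for the dual Hahn type a_i is quadratic and theta^*_i
   linear in i; for the q-Krawtchouk type a_i is a rational function of theta^*_i. A dependence
   thus gives a cubic polynomial with at least four roots. *)
theory Submission
  imports Defs
begin

section \<open>Diagonal entries from the split sequence\<close>

text \<open>The formula for \<open>a_i\<close> comes from a change of basis that is triangular: the
  split vector \<open>u_i\<close> involves only the eigenvectors of \<open>As\<close> with index at
  most \<open>i\<close>, so the subdiagonal entries of \<open>A\<close>, which are unknown, cancel.
  To reach polynomials one needs a single expression for \<open>a_i\<close> valid also at
  \<open>i = 0\<close> and \<open>i = d\<close>. It exists because the closed forms of \<phi> vanish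
  at \<open>0\<close> and \<open>d + 1\<close>. The nodes \<open>i\<close> or \<open>q^i\<close> are
  distinct because the \<open>\<theta>s i\<close> are, and the latter is part of having a Leonard
  system. The obstacle is the q-Krawtchouk type. There the continued sequence may satisfy
  \<theta>^*_(-1) = \<theta>^*_0 or \<theta>^*_(d+1) = \<theta>^*_d, and the rational function
  becomes 0/0 at that end. It then loses a common factor and has degree one, so three regular points
  and the separately computed end value suffice. If both ends are exceptional,
  \<open>q^(d+1) = -1\<close> and all interior values vanish. The Orphan type has no uniform formula
  in \<open>i\<close>; it is a system of four equations in characteristic 2, solved
  directly.\<close>

definition diagonal_entry ::
  "nat \<Rightarrow> (nat \<Rightarrow> 'a::field) \<Rightarrow> (nat \<Rightarrow> 'a) \<Rightarrow> (nat \<Rightarrow> 'a) \<Rightarrow> nat \<Rightarrow> 'a" where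
  "diagonal_entry d \<theta> \<theta>s \<phi> i = \<theta> i
     + (if i = 0 then 0 else \<phi> i / (\<theta>s i - \<theta>s (i - 1)))
     + (if i = d then 0 else \<phi> (Suc i) / (\<theta>s i - \<theta>s (Suc i)))"

section \<open>Coordinates, split vectors and primitive idempotents\<close>

lemma ordered_basis_coordinates:
  fixes scale :: "'a::field \<Rightarrow> 'v::ab_group_add \<Rightarrow> 'v"
  assumes "vector_space scale" "ordered_basis scale d v"
  obtains \<kappa> :: "nat \<Rightarrow> 'v \<Rightarrow> 'a"
  where "\<And>k. Vector_Spaces.linear scale (*) (\<kappa> k)"
    and "\<And>j k. j \<le> d \<Longrightarrow> k \<le> d \<Longrightarrow> \<kappa> k (v j) = (if j = k then 1 else 0)"
    and "\<And>x. x = (\<Sum>j\<le>d. scale (\<kappa> j x) (v j))"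
proof -
  interpret vector_space scale by fact
  have inj: "inj_on v {..d}" and ind: "independent (v ` {..d})" and sp: "span (v ` {..d}) = UNIV"
    using assms(2) by (auto simp: ordered_basis_def)
  define \<kappa> where "\<kappa> = (\<lambda>k x. representation (v ` {..d}) x (v k))"
  show ?thesis
  proof
    show "Vector_Spaces.linear scale (*) (\<kappa> k)" for k
      unfolding \<kappa>_def
      by unfold_locales
         (auto simp: sp representation_add[OF ind] representation_scale[OF ind] algebra_simps)
    show "\<kappa> k (v j) = (if j = k then 1 else 0)" if "j \<le> d" "k \<le> d" for j k
      using that inj unfolding \<kappa>_def
      by (auto simp: representation_basis[OF ind] inj_on_def)
    show "x = (\<Sum>j\<le>d. scale (\<kappa> j x) (v j))" for x
    proof -
      have "x = (\<Sum>b\<in>v ` {..d}. scale (representation (v ` {..d}) x b) b)"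
        using sum_representation_eq[OF ind, of x "v ` {..d}"] sp by auto
      also have "\<dots> = (\<Sum>j\<le>d. scale (\<kappa> j x) (v j))"
        unfolding \<kappa>_def using inj by (simp add: sum.reindex)
      finally show ?thesis .
    qed
  qed
qed

text \<open>On an eigenvector for \<open>\<eta> j\<close> each factor of the split vector acts as
  the scalar \<open>\<eta> j - \<theta> k\<close>. With \<open>\<eta> = \<theta>\<close> and
  \<open>i = Suc d\<close> every product contains a zero factor, so the split vector of index
  \<open>Suc d\<close> vanishes.\<close>

lemma split_vector_eigenvectors:
  fixes scale :: "'a::field \<Rightarrow> 'v::ab_group_add \<Rightarrow> 'v"
  assumes "Vector_Spaces.linear scale scale A"
    and eig: "\<And>j. j \<in> J \<Longrightarrow> A (w j) = scale (\<eta> j) (w j)"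
  shows "split_vector scale A \<theta> (\<Sum>j\<in>J. scale (c j) (w j)) i
    = (\<Sum>j\<in>J. scale (c j * (\<Prod>k<i. \<eta> j - \<theta> k)) (w j))"
proof -
  interpret Vector_Spaces.linear scale scale A by fact
  show ?thesis
  proof (induction i)
    case (Suc i)
    show ?case
      by (simp add: Suc sum vs1.scale_sum_right scale eig flip: sum_subtractf vs1.scale_left_diff_distrib
          cong: sum.cong_simp) (simp add: algebra_simps)
  qed simp
qed

text \<open>The range of \<open>E i\<close> is an eigenspace, and a nonzero vector belongs to only
  one eigenvalue. This identifies the sequences that the definitions of Leonard system and split
  sequence quantify existentially with those of the parameter array.\<close>

lemma eigenvalue_sequence_unique:
  assumes "vector_space scale"
    and "eigenvalue_sequence scale d A E \<theta>" "eigenvalue_sequence scale d A E \<eta>" "i \<le> d"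
  shows "\<theta> i = \<eta> i"
proof -
  interpret vector_space scale by fact
  have "eigenspace scale A (\<theta> i) = eigenspace scale A (\<eta> i)" "eigenvalue scale A (\<theta> i)"
    using assms(2-4)
    by (auto simp: eigenvalue_sequence_def primitive_idempotent_def projection_along_def)
  then obtain v where "v \<noteq> 0" "A v = scale (\<theta> i) v" "v \<in> eigenspace scale A (\<eta> i)"
    unfolding eigenvalue_def by (metis (mono_tags) eigenspace_def mem_Collect_eq)
  then show ?thesis by (simp add: eigenspace_def)
qed

lemma primitive_idempotent_eigenvector:
  assumes "vector_space scale" "primitive_idempotent scale A s P" "A w = scale t w"
  shows "P w = (if t = s then w else 0)"
proof -
  interpret vector_space scale by fact
  have fixed: "\<forall>w\<in>eigenspace scale A s. P w = w"
    and kernel: "{v. P v = 0} = span (\<Union>u\<in>- {s}. eigenspace scale A u)"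
    using assms(2) by (auto simp: primitive_idempotent_def projection_along_def)
  show ?thesis
  proof (cases "t = s")
    case True
    then show ?thesis using fixed assms(3) by (simp add: eigenspace_def)
  next
    case False
    then have "w \<in> span (\<Union>u\<in>- {s}. eigenspace scale A u)"
      using assms(3) by (intro span_base) (auto simp: eigenspace_def)
    then show ?thesis using kernel False by auto
  qed
qed

text \<open>The split vector \<open>u i\<close> has coordinates \<open>u i k\<close> in an eigenbasis of \<open>As\<close>; it is supported
  on \<open>k \<le> i\<close>, and comparing the two topmost coordinates in the actions of \<open>A\<close> and \<open>As\<close> gives the
  diagonal of \<open>A\<close>.\<close>

lemma tridiagonal_diagonal_entry:
  fixes M u :: "nat \<Rightarrow> nat \<Rightarrow> 'a::field"
  assumes tri: "irreducible_tridiagonal d M"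
    and u0: "\<And>k. k \<le> d \<Longrightarrow> u 0 k = (if k = 0 then 1 else 0)"
    and uA: "\<And>i k. k \<le> d \<Longrightarrow> u (Suc i) k = (\<Sum>j\<le>d. M k j * u i j) - \<theta> i * u i k"
    and uAs: "\<And>i k. i < d \<Longrightarrow> k \<le> d \<Longrightarrow>
      \<theta>s k * u (Suc i) k = \<theta>s (Suc i) * u (Suc i) k + \<phi> (Suc i) * u i k"
    and ud: "u (Suc d) d = 0"
    and inj: "inj_on \<theta>s {..d}"
    and i: "i \<le> d"
  shows "M i i = diagonal_entry d \<theta> \<theta>s \<phi> i"
proof -
  have M0: "M k j = 0" if "k \<le> d" "j \<le> d" "k > Suc j \<or> j > Suc k" for k j
    using tri that by (auto simp: irreducible_tridiagonal_def tridiagonal_def)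
  have Msub: "M (Suc k) k \<noteq> 0" if "k < d" for k
    using tri that by (auto simp: irreducible_tridiagonal_def)
  have zero: "u i k = 0" if "i < k" "k \<le> d" for i k
    using that
  proof (induction i arbitrary: k)
    case 0
    then show ?case by (simp add: u0)
  next
    case (Suc i)
    have "M k j * u i j = 0" if "j \<le> d" for j
    proof (cases "j \<le> i")
      case True
      then show ?thesis using Suc.prems that M0[of k j] by simp
    next
      case False
      then show ?thesis using Suc.IH[of j] that by simp
    qed
    then have "(\<Sum>j\<le>d. M k j * u i j) = 0" by (intro sum.neutral) auto
    then show ?case using Suc by (simp add: uA)
  qed
  have sub: "u (Suc i) (Suc i) = M (Suc i) i * u i i" if "i < d" for i
  proof -
    have "(\<Sum>j\<le>d. M (Suc i) j * u i j) = (\<Sum>j\<in>{i}. M (Suc i) j * u i j)"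
    proof (rule sum.mono_neutral_right)
      show "\<forall>j\<in>{..d} - {i}. M (Suc i) j * u i j = 0"
      proof
        fix j assume "j \<in> {..d} - {i}"
        then show "M (Suc i) j * u i j = 0"
          using that M0[of "Suc i" j] zero[of i j] by (cases "j < i") auto
      qed
    qed (use that in auto)
    then show ?thesis using that by (simp add: uA zero)
  qed
  have diag: "u i i \<noteq> 0" if "i \<le> d" for i
    using that
  proof (induction i)
    case (Suc i)
    then show ?case using sub[of i] Msub[of i] by simp
  qed (simp add: u0)
  have super: "u (Suc i) i / u i i = \<phi> (Suc i) / (\<theta>s i - \<theta>s (Suc i))" if "i < d" for i
  proof -
    have "\<theta>s i \<noteq> \<theta>s (Suc i)" using inj_onD[OF inj, of i "Suc i"] that by auto
    then show ?thesis using uAs[of i i] diag[of i] that by (simp add: field_simps)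
  qed
  have "u (Suc i) i / u i i = M i i
      + (if i = 0 then 0 else M i (i - 1) * u i (i - 1) / u i i) - \<theta> i"
  proof -
    have "(\<Sum>j\<le>d. M i j * u i j) = (\<Sum>j\<in>{i - 1, i}. M i j * u i j)"
    proof (rule sum.mono_neutral_right)
      show "\<forall>j\<in>{..d} - {i - 1, i}. M i j * u i j = 0"
      proof
        fix j assume "j \<in> {..d} - {i - 1, i}"
        then show "M i j * u i j = 0"
          using i M0[of i j] zero[of i j] by (cases "j < i") auto
      qed
    qed (use i in auto)
    then show ?thesis using i diag[of i] by (cases i) (simp_all add: uA field_simps)
  qed
  \<comment> \<open>The subdiagonal entry is the ratio of the leading coordinates
    \<open>u i i\<close> and \<open>u (i - 1) (i - 1)\<close>, so it cancels and leaves
    \<open>super\<close> at \<open>i - 1\<close>. The sign comes from exchanging the two eigenvalues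
    in the denominator.\<close>
  moreover have "M i (i - 1) * u i (i - 1) / u i i = - (\<phi> i / (\<theta>s i - \<theta>s (i - 1)))" if "i \<noteq> 0"
  proof -
    obtain j where j: "i = Suc j" using \<open>i \<noteq> 0\<close> by (cases i) auto
    have "M i (i - 1) * u i (i - 1) / u i i = u (Suc j) j / u j j"
      using j i sub[of j] diag[of "Suc j"] Msub[of j] by (simp add: field_simps)
    then show ?thesis using super[of j] j i by (simp add: minus_divide_right)
  qed
  \<comment> \<open>At \<open>i = d\<close> the vector \<open>u (Suc d)\<close> occurs, which the
    split relations do not reach; \<open>ud\<close> supplies its coordinate.\<close>
  moreover have "u (Suc i) i / u i i
      = (if i = d then 0 else \<phi> (Suc i) / (\<theta>s i - \<theta>s (Suc i)))"
    using super[of i] i ud by simp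
  ultimately show ?thesis by (simp add: diagonal_entry_def algebra_simps split: if_splits)
qed

section \<open>Reduction to linear independence of four functions of the index\<close>

lemma span_endomorphisms:
  fixes scale :: "'a::field \<Rightarrow> 'v::ab_group_add \<Rightarrow> 'v"
  assumes "vector_space scale"
  shows "X \<in> module.span (\<lambda>c (F :: 'v \<Rightarrow> 'v) x. scale c (F x)) {id, As, A, A \<circ> As} \<longleftrightarrow>
    (\<exists>\<alpha> \<beta> \<gamma> \<epsilon>. X = (\<lambda>x. scale \<alpha> x + scale \<beta> (As x) + scale \<gamma> (A x) + scale \<epsilon> (A (As x))))"
proof -
  interpret vector_space scale by fact
  have "module (\<lambda>c (F :: 'v \<Rightarrow> 'v) x. scale c (F x))"
    by unfold_locales (auto simp: algebra_simps fun_eq_iff)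
  note span_simps = module.span_breakdown_eq[OF this] module.span_empty[OF this]
  have "X - F1 - F2 - F3 - F4 = 0 \<longleftrightarrow> X = (\<lambda>x. F1 x + F2 x + F3 x + F4 x)"
    for F1 F2 F3 F4 :: "'v \<Rightarrow> 'v"
    by (auto simp: fun_eq_iff diff_diff_eq)
  then show ?thesis
    by (simp only: span_simps singleton_iff id_apply o_apply)
qed

text \<open>\<open>Es i\<close> has rank one, \<open>Es i x\<close> being the \<open>i\<close>-th
  coordinate of \<open>x\<close> times \<open>v i\<close>. Hence
  \<open>Es i \<circ> X \<circ> Es i = 0\<close> is one scalar equation, the vanishing of the
  \<open>i\<close>-th coordinate of \<open>X (v i)\<close>; in it \<open>A (As (v i))\<close>
  contributes \<open>\<theta>s i * M i i\<close>. Injectivity of \<open>\<theta>s\<close> is handed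
  to \<open>indep\<close> so that the types need not prove it from their formulas.\<close>

lemma zero_diagonal_space_trivial:
  fixes scale :: "'a::field \<Rightarrow> 'v::ab_group_add \<Rightarrow> 'v"
  assumes vs: "vector_space scale"
    and ls: "leonard_system scale d A E As Es"
    and pa: "parameter_array scale d A E As Es \<theta> \<theta>s \<phi> \<psi>"
    and indep: "\<And>\<alpha> \<beta> \<gamma> \<epsilon>. inj_on \<theta>s {..d} \<Longrightarrow>
      (\<And>i. i \<le> d \<Longrightarrow>
        \<alpha> + \<beta> * \<theta>s i + (\<gamma> + \<epsilon> * \<theta>s i) * diagonal_entry d \<theta> \<theta>s \<phi> i = 0) \<Longrightarrow>
      \<alpha> = 0 \<and> \<beta> = 0 \<and> \<gamma> = 0 \<and> \<epsilon> = 0"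
  shows "zero_diagonal_space scale d A As Es = {\<lambda>_. 0}"
proof -
  interpret vector_space scale by fact
  have linA: "Vector_Spaces.linear scale scale A" and linAs: "Vector_Spaces.linear scale scale As"
    using ls by (auto simp: leonard_system_def leonard_pair_def)
  interpret A: Vector_Spaces.linear scale scale A by fact
  interpret As: Vector_Spaces.linear scale scale As by fact
  have esA: "eigenvalue_sequence scale d A E \<theta>" and esAs: "eigenvalue_sequence scale d As Es \<theta>s"
    using pa by (auto simp: parameter_array_def)
  obtain \<eta> where "standard_ordering scale d A As \<eta>" and "eigenvalue_sequence scale d A E \<eta>"
    using ls by (auto simp: leonard_system_def)
  moreover note \<eta> = eigenvalue_sequence_unique[OF vs this(2) esA]
  ultimately obtain w where w: "\<And>i. i \<le> d \<Longrightarrow> A (w i) = scale (\<theta> i) (w i)"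
    and w_basis: "ordered_basis scale d w"
    by (auto simp: standard_ordering_def tridiagonal_diagonal_basis_def)
  obtain \<eta>s where so: "standard_ordering scale d As A \<eta>s"
    and "eigenvalue_sequence scale d As Es \<eta>s"
    using ls by (auto simp: leonard_system_def)
  then have \<eta>s: "\<And>i. i \<le> d \<Longrightarrow> \<eta>s i = \<theta>s i"
    using eigenvalue_sequence_unique[OF vs _ esAs] by blast
  have inj: "inj_on \<theta>s {..d}"
    using so \<eta>s unfolding standard_ordering_def bij_betw_def by (auto simp: inj_on_def)
  from so \<eta>s obtain v M where v: "\<And>i. i \<le> d \<Longrightarrow> v i \<noteq> 0 \<and> As (v i) = scale (\<theta>s i) (v i)"
    and v_basis: "ordered_basis scale d v"
    and M: "matrix_wrt scale d v A M" and tri: "irreducible_tridiagonal d M"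
    unfolding standard_ordering_def tridiagonal_diagonal_basis_def by auto
  obtain \<kappa> where lin: "\<And>k. Vector_Spaces.linear scale (*) (\<kappa> k)"
    and \<kappa>v: "\<And>j k. j \<le> d \<Longrightarrow> k \<le> d \<Longrightarrow> \<kappa> k (v j) = (if j = k then 1 else 0)"
    and expand: "\<And>x. x = (\<Sum>j\<le>d. scale (\<kappa> j x) (v j))"
    using ordered_basis_coordinates[OF vs v_basis] by blast
  obtain \<mu> where expand_w: "\<And>x. x = (\<Sum>j\<le>d. scale (\<mu> j x) (w j))"
    using ordered_basis_coordinates[OF vs w_basis] by metis
  have \<kappa>_add: "\<kappa> k (x + y) = \<kappa> k x + \<kappa> k y" and \<kappa>_scale: "\<kappa> k (scale c x) = c * \<kappa> k x"
    and \<kappa>_diff: "\<kappa> k (x - y) = \<kappa> k x - \<kappa> k y" and \<kappa>_0: "\<kappa> k 0 = 0"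
    and \<kappa>_sum: "\<kappa> k (sum f S) = (\<Sum>j\<in>S. \<kappa> k (f j))" for k x y c f and S :: "nat set"
  proof -
    interpret K: Vector_Spaces.linear scale "(*)" "\<kappa> k" by (rule lin)
    show "\<kappa> k (x + y) = \<kappa> k x + \<kappa> k y" "\<kappa> k (scale c x) = c * \<kappa> k x"
      "\<kappa> k (x - y) = \<kappa> k x - \<kappa> k y" "\<kappa> k 0 = 0" "\<kappa> k (sum f S) = (\<Sum>j\<in>S. \<kappa> k (f j))"
      by (rule K.add K.scale K.diff K.zero K.sum)+
  qed
  have Av: "A (v j) = (\<Sum>i\<le>d. scale (M i j) (v i))" if "j \<le> d" for j
    using M that by (simp add: matrix_wrt_def)
  have \<kappa>Av: "\<kappa> k (A (v j)) = M k j" if "k \<le> d" "j \<le> d" for k j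
    using that by (simp add: Av \<kappa>_sum \<kappa>_scale \<kappa>v if_distrib cong: if_cong sum.cong_simp)
  have \<kappa>A: "\<kappa> k (A x) = (\<Sum>j\<le>d. M k j * \<kappa> j x)" if "k \<le> d" for k x
  proof -
    have "\<kappa> k (A x) = \<kappa> k (A (\<Sum>j\<le>d. scale (\<kappa> j x) (v j)))"
      by (rule arg_cong[where f = "\<lambda>y. \<kappa> k (A y)", OF expand])
    also have "\<dots> = (\<Sum>j\<le>d. M k j * \<kappa> j x)"
      using that by (simp add: A.sum A.scale \<kappa>_sum \<kappa>_scale \<kappa>Av mult.commute cong: sum.cong_simp)
    finally show ?thesis .
  qed
  have \<kappa>As: "\<kappa> k (As x) = \<theta>s k * \<kappa> k x" if "k \<le> d" for k x
  proof -
    have "\<kappa> k (As x) = \<kappa> k (As (\<Sum>j\<le>d. scale (\<kappa> j x) (v j)))"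
      by (rule arg_cong[where f = "\<lambda>y. \<kappa> k (As y)", OF expand])
    also have "\<dots> = \<theta>s k * \<kappa> k x"
      using that v by (simp add: As.sum As.scale \<kappa>_sum \<kappa>_scale \<kappa>v if_distrib cong: if_cong sum.cong_simp)
    finally show ?thesis .
  qed
  have Es: "Es i (v j) = (if j = i then v i else 0)" if "i \<le> d" "j \<le> d" for i j
  proof -
    have "primitive_idempotent scale As (\<theta>s i) (Es i)"
      using esAs that by (simp add: eigenvalue_sequence_def)
    then have "Es i (v j) = (if \<theta>s j = \<theta>s i then v j else 0)"
      using v[OF that(2)] by (blast intro: primitive_idempotent_eigenvector[OF vs])
    then show ?thesis using inj_on_eq_iff[OF inj, of j i] that by simp
  qed
  have linEs: "Vector_Spaces.linear scale scale (Es i)" if "i \<le> d" for i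
    using esAs that
    by (simp add: eigenvalue_sequence_def primitive_idempotent_def projection_along_def)
  have Es_coord: "Es i x = scale (\<kappa> i x) (v i)" if "i \<le> d" for i x
  proof -
    interpret P: Vector_Spaces.linear scale scale "Es i" by (rule linEs) fact
    have "Es i x = Es i (\<Sum>j\<le>d. scale (\<kappa> j x) (v j))"
      by (rule arg_cong[where f = "Es i", OF expand])
    also have "\<dots> = (\<Sum>j\<le>d. scale (\<kappa> j x) (Es i (v j)))"
      by (simp only: P.sum P.scale)
    also have "\<dots> = (\<Sum>j\<le>d. if j = i then scale (\<kappa> i x) (v i) else 0)"
      using that by (intro sum.cong) (auto simp: Es)
    finally show ?thesis using that by simp
  qed
  define u where "u = split_vector scale A \<theta> (v 0)"
  obtain \<zeta> \<zeta>s where \<zeta>: "eigenvalue_sequence scale d A E \<zeta>" "eigenvalue_sequence scale d As Es \<zeta>s"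
    and split: "\<forall>x \<in> range (Es 0). x \<noteq> 0 \<longrightarrow>
           (\<forall>i\<in>{1..d}. As (split_vector scale A \<zeta> x i) =
              scale (\<zeta>s i) (split_vector scale A \<zeta> x i) +
              scale (\<phi> i) (split_vector scale A \<zeta> x (i - 1)))"
    using pa unfolding parameter_array_def first_split_sequence_def by blast
  have same: "split_vector scale A \<zeta> x i = split_vector scale A \<theta> x i" if "i \<le> Suc d" for x i
    using that
    by (induction i) (simp_all add: eigenvalue_sequence_unique[OF vs \<zeta>(1) esA])
  have "v 0 \<in> range (Es 0)" using Es[of 0 0] by (metis le0 rangeI)
  then have "As (u i) = scale (\<theta>s i) (u i) + scale (\<phi> i) (u (i - 1))" if "i \<in> {1..d}" for i
    using split v[of 0] that same eigenvalue_sequence_unique[OF vs \<zeta>(2) esAs, of i]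
    by (auto simp: u_def)
  then have Asu: "As (u (Suc i)) = scale (\<theta>s (Suc i)) (u (Suc i)) + scale (\<phi> (Suc i)) (u i)"
    if "i < d" for i
    using that by (metis Suc_leI atLeastAtMost_iff diff_Suc_1 le_add1 plus_1_eq_Suc)
  have ud: "u (Suc d) = 0"
  proof -
    have "u (Suc d) = (\<Sum>j\<le>d. scale (\<mu> j (v 0) * (\<Prod>k<Suc d. \<theta> j - \<theta> k)) (w j))"
      unfolding u_def
      by (subst expand_w[of "v 0"], rule split_vector_eigenvectors[OF linA]) (simp add: w)
    also have "\<dots> = 0"
    proof (intro sum.neutral ballI)
      fix j assume "j \<in> {..d}"
      then have "(\<Prod>k<Suc d. \<theta> j - \<theta> k) = 0" by (intro prod_zero) (auto intro!: bexI[of _ j])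
      then show "scale (\<mu> j (v 0) * (\<Prod>k<Suc d. \<theta> j - \<theta> k)) (w j) = 0" by simp
    qed
    finally show ?thesis .
  qed
  have diag: "M i i = diagonal_entry d \<theta> \<theta>s \<phi> i" if "i \<le> d" for i
  proof (rule tridiagonal_diagonal_entry[where M = M and u = "\<lambda>i k. \<kappa> k (u i)"])
    show "\<theta>s k * \<kappa> k (u (Suc i)) = \<theta>s (Suc i) * \<kappa> k (u (Suc i)) + \<phi> (Suc i) * \<kappa> k (u i)"
      if "i < d" "k \<le> d" for i k
      using arg_cong[OF Asu[OF that(1)], of "\<kappa> k"] \<kappa>As[OF that(2), of "u (Suc i)"]
      by (simp only: \<kappa>_add \<kappa>_scale)
    show "\<kappa> d (u (Suc d)) = 0" by (simp only: ud \<kappa>_0)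
  qed (use that in \<open>simp_all add: tri inj \<kappa>v \<kappa>_diff \<kappa>_scale \<kappa>A u_def\<close>)
  show ?thesis
  proof (intro equalityI subsetI)
    fix X assume X: "X \<in> zero_diagonal_space scale d A As Es"
    then obtain \<alpha> \<beta> \<gamma> \<epsilon> where X_eq:
      "X = (\<lambda>x. scale \<alpha> x + scale \<beta> (As x) + scale \<gamma> (A x) + scale \<epsilon> (A (As x)))"
      unfolding zero_diagonal_space_def span_endomorphisms[OF vs] by blast
    have "\<alpha> + \<beta> * \<theta>s i + (\<gamma> + \<epsilon> * \<theta>s i) * diagonal_entry d \<theta> \<theta>s \<phi> i = 0" if "i \<le> d" for i
    proof -
      have "(Es i \<circ> X \<circ> Es i) (v i) = 0" using X that by (simp add: zero_diagonal_space_def)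
      then have "\<kappa> i (X (v i)) = 0" using that v by (simp add: Es_coord \<kappa>v)
      then have "\<alpha> + \<beta> * \<theta>s i + \<gamma> * M i i + \<epsilon> * \<theta>s i * M i i = 0"
        using that v[OF that] by (simp add: X_eq \<kappa>_add \<kappa>_scale \<kappa>v \<kappa>Av A.scale)
      then show ?thesis using diag[OF that] by (simp add: algebra_simps)
    qed
    then have "\<alpha> = 0 \<and> \<beta> = 0 \<and> \<gamma> = 0 \<and> \<epsilon> = 0" using indep[OF inj] by blast
    then show "X \<in> {\<lambda>_. 0}" by (simp add: X_eq)
  next
    fix X :: "'v \<Rightarrow> 'v" assume "X \<in> {\<lambda>_. 0}"
    then have X: "X = (\<lambda>_. 0)" by simp
    have "X = (\<lambda>x. scale 0 x + scale 0 (As x) + scale 0 (A x) + scale 0 (A (As x)))"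
      by (simp add: X)
    then have "X \<in> module.span (\<lambda>c F x. scale c (F x)) {id, As, A, A \<circ> As}"
      unfolding span_endomorphisms[OF vs] by blast
    then show "X \<in> zero_diagonal_space scale d A As Es"
      by (simp add: zero_diagonal_space_def X Es_coord \<kappa>_0 fun_eq_iff)
  qed
qed

section \<open>The dual Hahn and orphan types\<close>

lemma cubic_coeffs_zero:
  fixes c0 c1 c2 c3 :: "'a::field"
  assumes "card S \<ge> 4"
    and roots: "\<And>x. x \<in> S \<Longrightarrow> c0 + c1 * x + c2 * x ^ 2 + c3 * x ^ 3 = 0"
  shows "c0 = 0 \<and> c1 = 0 \<and> c2 = 0 \<and> c3 = 0"
proof (rule ccontr)
  define p where "p = [:c0, c1, c2, c3:]"
  assume "\<not> ?thesis"
  then have "p \<noteq> 0" by (auto simp: p_def)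
  have "S \<subseteq> {x. poly p x = 0}"
    using roots by (auto simp: p_def algebra_simps power2_eq_square power3_eq_cube)
  then have "card S \<le> card {x. poly p x = 0}"
    using poly_roots_finite[OF \<open>p \<noteq> 0\<close>] by (simp add: card_mono)
  also have "\<dots> \<le> degree p" using \<open>p \<noteq> 0\<close> by (rule card_poly_roots_bound)
  also have "\<dots> \<le> 3" by (auto simp: p_def intro!: degree_pCons_le[THEN order_trans])
  finally show False using assms(1) by simp
qed

lemma quadratic_coeffs_zero:
  fixes c0 c1 c2 :: "'a::field"
  assumes "card S \<ge> 3"
    and roots: "\<And>x. x \<in> S \<Longrightarrow> c0 + c1 * x + c2 * x ^ 2 = 0"
  shows "c0 = 0 \<and> c1 = 0 \<and> c2 = 0"
proof (rule ccontr)
  define p where "p = [:c0, c1, c2:]"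
  assume "\<not> ?thesis"
  then have "p \<noteq> 0" by (auto simp: p_def)
  have "S \<subseteq> {x. poly p x = 0}"
    using roots by (auto simp: p_def algebra_simps power2_eq_square)
  then have "card S \<le> card {x. poly p x = 0}"
    using poly_roots_finite[OF \<open>p \<noteq> 0\<close>] by (simp add: card_mono)
  also have "\<dots> \<le> degree p" using \<open>p \<noteq> 0\<close> by (rule card_poly_roots_bound)
  also have "\<dots> \<le> 2" by (auto simp: p_def intro!: degree_pCons_le[THEN order_trans])
  finally show False using assms(1) by simp
qed

lemma dual_Hahn_independent:
  fixes \<theta> \<theta>s \<phi> \<psi> :: "nat \<Rightarrow> 'a::field"
  assumes "dual_Hahn d \<theta> \<theta>s \<phi> \<psi>" and d: "d \<ge> 3" and inj: "inj_on \<theta>s {..d}"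
    and rel: "\<And>i. i \<le> d \<Longrightarrow>
      \<alpha> + \<beta> * \<theta>s i + (\<gamma> + \<epsilon> * \<theta>s i) * diagonal_entry d \<theta> \<theta>s \<phi> i = 0"
  shows "\<alpha> = 0 \<and> \<beta> = 0 \<and> \<gamma> = 0 \<and> \<epsilon> = 0"
proof -
  obtain h s t r where h: "h \<noteq> 0" and t: "t \<noteq> 0"
    and char: "CHAR('a) = 0 \<or> prime CHAR('a) \<and> CHAR('a) > d"
    and \<theta>: "\<And>i. i \<le> d \<Longrightarrow> \<theta> i = \<theta> 0 + h * of_nat i * (of_nat i + 1 + s)"
    and \<theta>s: "\<And>i. i \<le> d \<Longrightarrow> \<theta>s i = \<theta>s 0 + t * of_nat i"
    and \<phi>: "\<And>i. i \<in> {1..d} \<Longrightarrow>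
      \<phi> i = h * t * of_nat i * (of_nat i - of_nat d - 1) * (of_nat i + r)"
    using assms(1) unfolding dual_Hahn_def by blast
  \<comment> \<open>The leading coefficient of the diagonal entry will be \<open>- 2 * h\<close>;
    this is where the condition on the characteristic enters.\<close>
  have two: "(2::'a) \<noteq> 0"
    using char d of_nat_eq_0_iff_char_dvd[of 2, where 'a = 'a]
    by (auto dest: dvd_imp_le)
  define D where "D = (of_nat d :: 'a)"
  \<comment> \<open>The closed forms of \<open>\<phi> i\<close> and \<open>\<phi> (Suc i)\<close>
    contain the factors \<open>i\<close> and \<open>i - d\<close>, so \<open>\<rho>\<close> also
    covers the two ends. The cubic terms of the two products cancel; their difference contributes
    \<open>- 3 * h\<close> to the coefficient of \<open>x ^ 2\<close>, and \<open>\<theta>\<close>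
    contributes \<open>h\<close>.\<close>
  define \<rho> where "\<rho> = (\<lambda>x. \<theta> 0 + h * x * (x + 1 + s)
    + h * x * (x - D - 1) * (x + r) - h * (x + 1) * (x - D) * (x + 1 + r))"
  define b c where "b = h * (1 + s - (D + 1) * r - (1 - D) * (1 + r) + D)"
    and "c = \<theta> 0 + h * D * (1 + r)"
  have \<rho>_eq: "\<rho> x = c + b * x - 2 * h * x ^ 2" for x
    unfolding \<rho>_def b_def c_def by algebra
  have entry: "diagonal_entry d \<theta> \<theta>s \<phi> i = \<rho> (of_nat i)" if "i \<le> d" for i
  proof -
    have "\<phi> i / (\<theta>s i - \<theta>s (i - 1)) = h * of_nat i * (of_nat i - D - 1) * (of_nat i + r)"
      if "i \<noteq> 0"
    proof -
      have "\<theta>s i - \<theta>s (i - 1) = t"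
        using that \<open>i \<le> d\<close> \<theta>s[of i] \<theta>s[of "i - 1"] by (cases i) (simp_all add: algebra_simps)
      moreover have "\<phi> i = t * (h * of_nat i * (of_nat i - D - 1) * (of_nat i + r))"
        using that \<open>i \<le> d\<close> by (simp add: \<phi> D_def algebra_simps)
      ultimately show ?thesis using t by simp
    qed
    moreover have "\<phi> (Suc i) / (\<theta>s i - \<theta>s (Suc i))
      = - (h * (of_nat i + 1) * (of_nat i - D) * (of_nat i + 1 + r))" if "i \<noteq> d"
    proof -
      have "\<theta>s i - \<theta>s (Suc i) = - t"
        using that \<open>i \<le> d\<close> by (simp add: \<theta>s[of i] \<theta>s[of "Suc i"] algebra_simps)
      moreover have "\<phi> (Suc i) = t * (h * (of_nat i + 1) * (of_nat i - D) * (of_nat i + 1 + r))"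
        using that \<open>i \<le> d\<close> by (simp add: \<phi> D_def algebra_simps)
      ultimately show ?thesis using t by simp
    qed
    ultimately show ?thesis
      using \<theta>[OF that] by (auto simp: diagonal_entry_def \<rho>_def D_def)
  qed
  define S where "S = (of_nat :: nat \<Rightarrow> 'a) ` {..d}"
  have "inj_on (of_nat :: nat \<Rightarrow> 'a) {..d}"
    using inj \<theta>s unfolding inj_on_def by (metis atMost_iff)
  then have card: "card S \<ge> 4" using d by (simp add: S_def card_image)
  have "(\<alpha> + \<beta> * \<theta>s 0 + (\<gamma> + \<epsilon> * \<theta>s 0) * c)
      + (\<beta> * t + (\<gamma> + \<epsilon> * \<theta>s 0) * b + \<epsilon> * t * c) * x
      + (\<epsilon> * t * b - (\<gamma> + \<epsilon> * \<theta>s 0) * 2 * h) * x ^ 2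
      + (- 2 * \<epsilon> * t * h) * x ^ 3 = 0" if "x \<in> S" for x
  proof -
    obtain i where i: "i \<le> d" "x = of_nat i" using \<open>x \<in> S\<close> by (auto simp: S_def)
    have "\<alpha> + \<beta> * (\<theta>s 0 + t * x) + (\<gamma> + \<epsilon> * (\<theta>s 0 + t * x)) * \<rho> x = 0"
      using rel[OF i(1)] entry[OF i(1)] \<theta>s[OF i(1)] i(2) by simp
    then show ?thesis unfolding \<rho>_eq by algebra
  qed
  from cubic_coeffs_zero[OF card this] show ?thesis using two t h by auto
qed

text \<open>Subtracting the entry at index 0 removes \<open>r\<close> from the other three entries.
  The equation at index 0 then fixes \<open>A0\<close>, and eliminating \<open>B\<close> from the
  other three leaves two equations in \<open>g\<close> and \<open>m\<close> whose coefficients of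
  \<open>m\<close> differ by exactly 1.\<close>

lemma orphan_independent:
  fixes \<theta> \<theta>s \<phi> \<psi> :: "nat \<Rightarrow> 'a::field"
  assumes "orphan d \<theta> \<theta>s \<phi> \<psi>"
    and rel: "\<And>i. i \<le> d \<Longrightarrow>
      \<alpha> + \<beta> * \<theta>s i + (\<gamma> + \<epsilon> * \<theta>s i) * diagonal_entry d \<theta> \<theta>s \<phi> i = 0"
  shows "\<alpha> = 0 \<and> \<beta> = 0 \<and> \<gamma> = 0 \<and> \<epsilon> = 0"
proof -
  have d: "d = 3" and "CHAR('a) = 2" using assms(1) by (auto simp: orphan_def)
  then have two: "(2::'a) = 0" using of_nat_CHAR[where 'a = 'a] by simp
  obtain h k s w r where nz: "h \<noteq> 0" "k \<noteq> 0" "w \<noteq> 0" "w \<noteq> 1"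
    and \<theta>: "\<theta> 1 = \<theta> 0 + h * (s + 1)" "\<theta> 2 = \<theta> 0 + h" "\<theta> 3 = \<theta> 0 + h * s"
    and \<theta>s: "\<theta>s 1 = \<theta>s 0 + k * (w + 1)" "\<theta>s 2 = \<theta>s 0 + k" "\<theta>s 3 = \<theta>s 0 + k * w"
    and \<phi>: "\<phi> 1 = h * k * r" "\<phi> 2 = h * k" "\<phi> 3 = h * k * (r + s + w)"
    using assms(1) unfolding orphan_def by blast
  define v where "v = w + 1"
  have neg: "- x = x" for x :: 'a
    using two by (metis add_eq_0_iff mult_2 mult_zero_left)
  have v: "v \<noteq> 0" using nz neg[of 1] unfolding v_def by (metis add_eq_0_iff2)
  \<comment> \<open>The diagonal entry at index 0, since
    \<open>\<phi> 1 / (\<theta>s 0 - \<theta>s 1) = h * r / v\<close> in characteristic 2.\<close>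
  define a0 where "a0 = \<theta> 0 + h * r / v"
  define a where "a = (\<lambda>i. diagonal_entry d \<theta> \<theta>s \<phi> i - a0)"
  have diffs: "\<theta>s 1 - \<theta>s 0 = k * v" "\<theta>s 2 - \<theta>s 1 = k * w" "\<theta>s 3 - \<theta>s 2 = k * v"
  proof -
    show "\<theta>s 1 - \<theta>s 0 = k * v" unfolding \<theta>s v_def by simp
    show "\<theta>s 2 - \<theta>s 1 = k * w" unfolding \<theta>s using neg[of "k * w"] by (simp add: algebra_simps)
    have "\<theta>s 3 - \<theta>s 2 = k * v - 2 * k" unfolding \<theta>s v_def by (simp add: algebra_simps)
    then show "\<theta>s 3 - \<theta>s 2 = k * v" by (simp add: two)
  qed
  have diffs': "\<theta>s 0 - \<theta>s 1 = k * v" "\<theta>s 1 - \<theta>s 2 = k * w" "\<theta>s 2 - \<theta>s 3 = k * v"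
    using diffs neg by (metis minus_diff_eq)+
  have a_0: "a 0 = 0"
    using nz by (simp add: a_def a0_def diagonal_entry_def d \<phi>(1)[simplified] diffs'(1)[simplified])
  have a_1: "a 1 = h * (s + 1) + h / w"
    using nz by (simp add: a_def a0_def diagonal_entry_def d \<phi>[simplified] \<theta>[simplified]
        diffs[simplified] diffs'[simplified] numeral_2_eq_2[symmetric])
  have a_2: "a 2 = h + h / w + h * (s + w) / v"
  proof -
    have "a 2 = h + h / w + (h * (r + s + w) / v - h * r / v)"
      using nz by (simp add: a_def a0_def diagonal_entry_def d \<phi>[simplified] \<theta>[simplified]
          diffs[simplified] diffs'[simplified] numeral_3_eq_3[symmetric])
    also have "h * (r + s + w) / v - h * r / v = h * (s + w) / v"
      by (simp add: algebra_simps flip: diff_divide_distrib)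
    finally show ?thesis .
  qed
  have a_3: "a 3 = h * s + h * (s + w) / v"
  proof -
    have "a 3 = h * s + (h * (r + s + w) / v - h * r / v)"
      using nz by (simp add: a_def a0_def diagonal_entry_def d \<phi>[simplified] \<theta>[simplified]
          diffs[simplified])
    also have "h * (r + s + w) / v - h * r / v = h * (s + w) / v"
      by (simp add: algebra_simps flip: diff_divide_distrib)
    finally show ?thesis .
  qed
  \<comment> \<open>Coefficients of the relation rewritten in
    \<open>\<theta>s i - \<theta>s 0\<close> and \<open>a i\<close>, both of which vanish at
    \<open>i = 0\<close>.\<close>
  define g A0 B where "g = \<gamma> + \<epsilon> * \<theta>s 0"
    and "A0 = \<alpha> + \<beta> * \<theta>s 0 + (\<gamma> + \<epsilon> * \<theta>s 0) * a0" and "B = \<beta> + \<epsilon> * a0"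
  have shifted: "A0 + B * (\<theta>s i - \<theta>s 0) + (g + \<epsilon> * (\<theta>s i - \<theta>s 0)) * a i = 0" if "i \<le> 3" for i
  proof -
    have "\<alpha> + \<beta> * \<theta>s i + (\<gamma> + \<epsilon> * \<theta>s i) * (a i + a0) = 0"
      using rel[of i] that d by (simp add: a_def)
    then show ?thesis unfolding A0_def B_def g_def by algebra
  qed
  have "A0 = 0" using shifted[of 0] a_0 by simp
  have e1: "B * (k * v) + (g + \<epsilon> * (k * v)) * a 1 = 0"
    and e2: "B * k + (g + \<epsilon> * k) * a 2 = 0"
    and e3: "B * (k * w) + (g + \<epsilon> * (k * w)) * a 3 = 0"
    using shifted[of 1, unfolded diffs(1) \<open>A0 = 0\<close>] shifted[of 2] shifted[of 3] \<open>A0 = 0\<close>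
    by (simp_all add: \<theta>s)
  define m where "m = \<epsilon> * k"
  have "B * k * v * w + (g + m * v) * (h * (s * w + w + 1)) = 0"
  proof -
    have "a 1 * w = h * (s * w + w + 1)" unfolding a_1 using nz v by (simp add: field_simps)
    then show ?thesis using e1 unfolding m_def by algebra
  qed
  moreover have "B * k * w * v + (g + m) * (h * (1 + s * w)) = 0"
  proof -
    have "a 2 * (w * v) = h * (w * v + v + w * (s + w))" unfolding a_2 using nz v by (simp add: field_simps)
    also have "\<dots> = h * (1 + s * w) + 2 * (h * (w ^ 2 + w))" unfolding v_def by algebra
    finally have "a 2 * (w * v) = h * (1 + s * w)" by (simp add: two)
    then show ?thesis using e2 unfolding m_def by algebra
  qed
  moreover have "B * k * w * v + (g + m * w) * (h * (w * (s + 1))) = 0"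
  proof -
    have "a 3 * v = h * (s * v + s + w)" unfolding a_3 using nz v by (simp add: field_simps)
    also have "\<dots> = h * (w * (s + 1)) + 2 * (h * s)" unfolding v_def by algebra
    finally have "a 3 * v = h * (w * (s + 1))" by (simp add: two)
    then show ?thesis using e3 unfolding m_def by algebra
  qed
  \<comment> \<open>First minus second and second minus third of the three equations. They hold over
    any field; the multiples of 2 record the terms that disappear in characteristic 2.\<close>
  ultimately have "h * w * (g + m * w * (s + 1)) + 2 * (h * m * w) = 0 \<and>
      h * v * (g + m * (1 + w + s * w)) = 2 * (h * (g * w + m * (w + w ^ 2 + s * w ^ 2)))"
    unfolding v_def by algebra
  then have "g + m * w * (s + 1) = 0" "g + m * (1 + w + s * w) = 0" using nz v by (simp_all add: two)
  then have m: "m = 0" by algebra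
  with \<open>g + m * w * (s + 1) = 0\<close> have g: "g = 0" by simp
  have "\<epsilon> = 0" using m nz by (simp add: m_def)
  moreover from this g have "\<gamma> = 0" by (simp add: g_def)
  moreover have "B = 0" using e2 g nz \<open>\<epsilon> = 0\<close> by simp
  ultimately show ?thesis using \<open>A0 = 0\<close> by (simp add: A0_def B_def)
qed

section \<open>The \<open>q\<close>-types\<close>

text \<open>\<open>T\<close> and \<open>P\<close> continue the sequences to the powers of
  \<open>q\<close> with exponents \<open>-1\<close> and \<open>d + 1\<close>. Since \<open>P\<close>
  vanishes at \<open>1\<close> and \<open>q ^ Suc d\<close>, the quotients added at the two ends
  have numerator 0. They are 0 even if their denominator vanishes, because division by zero yields
  0.\<close>

lemma diagonal_entry_q:
  fixes q :: "'a::field"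
  assumes "i \<le> d" "q \<noteq> 0"
    and T: "\<And>j. j \<le> d \<Longrightarrow> \<theta>s j = T (q ^ j)"
    and P: "\<And>j. j \<in> {1..d} \<Longrightarrow> \<phi> j = P (q ^ j)"
    and boundary: "P 1 = 0" "P (q ^ Suc d) = 0"
  shows "diagonal_entry d \<theta> \<theta>s \<phi> i = \<theta> i + P (q ^ i) / (T (q ^ i) - T (q ^ i / q))
    + P (q * q ^ i) / (T (q ^ i) - T (q * q ^ i))"
proof -
  have "P (q ^ i) / (T (q ^ i) - T (q ^ i / q))
    = (if i = 0 then 0 else \<phi> i / (\<theta>s i - \<theta>s (i - 1)))"
    using assms(1,2) boundary T[of i] T[of "i - 1"] P[of i] by (cases i) auto
  moreover have "P (q * q ^ i) / (T (q ^ i) - T (q * q ^ i))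
    = (if i = d then 0 else \<phi> (Suc i) / (\<theta>s i - \<theta>s (Suc i)))"
    using assms(1,2) boundary T[of i] T[of "Suc i"] P[of "Suc i"] by auto
  ultimately show ?thesis by (simp add: diagonal_entry_def)
qed

lemma one_plus_minus_nonzero:
  fixes q :: "'a::field"
  assumes "q ^ 2 \<noteq> 1"
  shows "1 + q \<noteq> 0" "1 - q \<noteq> 0"
proof -
  have "(1 + q) * (1 - q) \<noteq> 0" using assms by (simp add: algebra_simps power2_eq_square)
  then show "1 + q \<noteq> 0" "1 - q \<noteq> 0" by auto
qed

text \<open>Multiplying the relation by \<open>y = q ^ i\<close> clears the pole of
  \<open>\<theta>s i\<close> and gives a cubic in \<open>y\<close>. As \<open>c2\<close> and
  \<open>k\<close> are nonzero, its coefficients are killed in turn: \<open>y ^ 3\<close> and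
  \<open>y ^ 2\<close> give \<epsilon> = \<gamma> = 0, the constant term gives \<beta> = 0, and
  \<alpha> = 0 remains.\<close>

lemma laurent_independent:
  fixes \<theta>s D :: "nat \<Rightarrow> 'a::field"
  assumes d: "d \<ge> 3" and inj: "inj_on \<theta>s {..d}" and q: "q \<noteq> 0" and k: "k \<noteq> 0"
    and \<theta>s: "\<And>i. i \<le> d \<Longrightarrow> \<theta>s i = t + k * (1 - q ^ i) / q ^ i"
    and D: "\<And>i. i \<le> d \<Longrightarrow> D i = c0 + c1 * q ^ i + c2 * (q ^ i) ^ 2" and c2: "c2 \<noteq> 0"
    and rel: "\<And>i. i \<le> d \<Longrightarrow> \<alpha> + \<beta> * \<theta>s i + (\<gamma> + \<epsilon> * \<theta>s i) * D i = 0"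
  shows "\<alpha> = 0 \<and> \<beta> = 0 \<and> \<gamma> = 0 \<and> \<epsilon> = 0"
proof -
  define S where "S = (\<lambda>i. q ^ i) ` {..d}"
  have "inj_on (\<lambda>i. q ^ i) {..d}" using inj \<theta>s by (auto simp: inj_on_def)
  then have card: "card S \<ge> 4" using d by (simp add: S_def card_image)
  define u where "u = t - k"
  have "(k * \<beta> + \<epsilon> * k * c0) + (\<alpha> + \<beta> * u + (\<gamma> + \<epsilon> * u) * c0 + \<epsilon> * k * c1) * y
      + ((\<gamma> + \<epsilon> * u) * c1 + \<epsilon> * k * c2) * y ^ 2 + ((\<gamma> + \<epsilon> * u) * c2) * y ^ 3 = 0"
    if "y \<in> S" for y
  proof -
    obtain i where i: "i \<le> d" "y = q ^ i" using \<open>y \<in> S\<close> by (auto simp: S_def)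
    define z where "z = 1 / y"
    have "y * z = 1" using i q by (simp add: z_def)
    have "\<theta>s i = u + k * z" using \<theta>s[OF i(1)] i q by (simp add: u_def z_def field_simps)
    then have "\<alpha> + \<beta> * (u + k * z) + (\<gamma> + \<epsilon> * (u + k * z)) * (c0 + c1 * y + c2 * y ^ 2) = 0"
      using rel[OF i(1)] D[OF i(1)] i(2) by simp
    then show ?thesis using \<open>y * z = 1\<close> by algebra
  qed
  from cubic_coeffs_zero[OF card this] show ?thesis using c2 k by auto
qed

text \<open>\<open>s = 0\<close> is the affine \<open>q\<close>-Krawtchouk case.\<close>

lemma dual_q_Hahn_family_independent:
  fixes \<theta> \<theta>s \<phi> :: "nat \<Rightarrow> 'a::field"
  assumes d: "d \<ge> 3" and inj: "inj_on \<theta>s {..d}"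
    and nz: "q \<noteq> 0" "h \<noteq> 0" "k \<noteq> 0" "r \<noteq> 0" "q ^ 2 \<noteq> 1"
    and \<theta>: "\<And>i. i \<le> d \<Longrightarrow> \<theta> i = \<theta> 0 + h * (1 - q ^ i) * (1 - s * q ^ (i + 1)) * q powi (- int i)"
    and \<theta>s: "\<And>i. i \<le> d \<Longrightarrow> \<theta>s i = \<theta>s 0 + k * (1 - q ^ i) * q powi (- int i)"
    and \<phi>: "\<And>i. i \<in> {1..d} \<Longrightarrow> \<phi> i = h * k * q powi (1 - 2 * int i) * (1 - q ^ i) *
       (1 - q powi (int i - int d - 1)) * (1 - r * q ^ i)"
    and rel: "\<And>i. i \<le> d \<Longrightarrow>
      \<alpha> + \<beta> * \<theta>s i + (\<gamma> + \<epsilon> * \<theta>s i) * diagonal_entry d \<theta> \<theta>s \<phi> i = 0"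
  shows "\<alpha> = 0 \<and> \<beta> = 0 \<and> \<gamma> = 0 \<and> \<epsilon> = 0"
proof -
  \<comment> \<open>\<open>1 - y * Q\<close> is the factor of \<phi> that vanishes at
    \<open>y = q ^ Suc d\<close>.\<close>
  define Q where "Q = 1 / q ^ Suc d"
  have Q: "Q \<noteq> 0" using nz by (simp add: Q_def)
  have q1: "1 + q \<noteq> 0" "1 - q \<noteq> 0"
    using one_plus_minus_nonzero nz by auto
  have T: "\<theta>s i = \<theta>s 0 + k * (1 - q ^ i) / q ^ i" if "i \<le> d" for i
    using \<theta>s[OF that] by (simp add: power_int_minus divide_inverse)
  have P: "\<phi> i = h * k * q / (q ^ i) ^ 2 * (1 - q ^ i) * (1 - q ^ i * Q) * (1 - r * q ^ i)"
    if "i \<in> {1..d}" for i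
  proof -
    have "q powi (1 - 2 * int i) = q / (q ^ i) ^ 2"
    proof -
      have "q powi (1 - 2 * int i) = q / q powi int (2 * i)"
        using nz by (simp add: power_int_diff)
      also have "q powi int (2 * i) = (q ^ i) ^ 2"
        by (simp only: power_int_of_nat power_even_eq)
      finally show ?thesis .
    qed
    moreover have "q powi (int i - int d - 1) = q ^ i * Q"
      using nz by (simp add: power_int_diff Q_def)
    ultimately show ?thesis by (simp add: \<phi>[OF that])
  qed
  have entry: "diagonal_entry d \<theta> \<theta>s \<phi> i = (\<theta> 0 - h * (1 + s * q))
      + h * q * (s + Q + r + r * Q) * q ^ i + (- h * r * Q * q * (1 + q)) * (q ^ i) ^ 2"
    if "i \<le> d" for i
  proof -
    define y where "y = q ^ i"
    have y: "y \<noteq> 0" using nz by (simp add: y_def)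
    have clear: "(a + b / y + c / (z * y) + - (e / (z * y))) * (z * y) = a * (z * y) + b * z + c - e"
      if "z \<noteq> 0" for a b c e z
      using that y by (simp add: field_simps)
    have "diagonal_entry d \<theta> \<theta>s \<phi> i = \<theta> i
      + h * k * q / y ^ 2 * (1 - y) * (1 - y * Q) * (1 - r * y)
        / (\<theta>s 0 + k * (1 - y) / y - (\<theta>s 0 + k * (1 - y / q) / (y / q)))
      + h * k * q / (q * y) ^ 2 * (1 - q * y) * (1 - q * y * Q) * (1 - r * (q * y))
        / (\<theta>s 0 + k * (1 - y) / y - (\<theta>s 0 + k * (1 - q * y) / (q * y)))"
      unfolding y_def
      by (rule diagonal_entry_q[where T = "\<lambda>y. \<theta>s 0 + k * (1 - y) / y"
              and P = "\<lambda>y. h * k * q / y ^ 2 * (1 - y) * (1 - y * Q) * (1 - r * y)",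
              OF that nz(1) T P]) (use nz in \<open>simp_all add: Q_def\<close>)
    also have "\<theta>s 0 + k * (1 - y) / y - (\<theta>s 0 + k * (1 - y / q) / (y / q)) = k * (1 - q) / y"
      using y nz by (simp add: field_simps)
    also have "\<theta>s 0 + k * (1 - y) / y - (\<theta>s 0 + k * (1 - q * y) / (q * y)) = - (k * (1 - q)) / (q * y)"
      using y nz by (simp add: field_simps)
    also have "\<theta> i = \<theta> 0 + h * (1 - y) * (1 - s * q * y) / y"
      using \<theta>[OF that] by (simp add: y_def power_int_minus divide_inverse)
    also have "h * k * q / y ^ 2 * (1 - y) * (1 - y * Q) * (1 - r * y) / (k * (1 - q) / y)
      = h * q * (1 - y) * (1 - y * Q) * (1 - r * y) / ((1 - q) * y)"
      using y nz q1 by (simp add: power2_eq_square mult_ac)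
    also have "h * k * q / (q * y) ^ 2 * (1 - q * y) * (1 - q * y * Q) * (1 - r * (q * y))
        / (- (k * (1 - q)) / (q * y))
      = - (h * (1 - q * y) * (1 - q * y * Q) * (1 - r * (q * y)) / ((1 - q) * y))"
      using y nz q1 by (simp add: power2_eq_square divide_simps)
    finally have "diagonal_entry d \<theta> \<theta>s \<phi> i * ((1 - q) * y) = \<theta> 0 * ((1 - q) * y)
      + h * (1 - y) * (1 - s * q * y) * (1 - q) + h * q * (1 - y) * (1 - y * Q) * (1 - r * y)
      - h * (1 - q * y) * (1 - q * y * Q) * (1 - r * (q * y))"
      by (simp only: clear[OF q1(2)])
    \<comment> \<open>The cubic has no constant term, so \<open>y\<close> divides out. Its leading
      coefficient carries the factor \<open>1 - q ^ 2\<close>, which explains the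
      \<open>1 + q\<close> left over after division by \<open>1 - q\<close>; it is nonzero because
      \<open>q ^ 2 \<noteq> 1\<close>.\<close>
    also have "\<dots> = ((\<theta> 0 - h * (1 + s * q))
      + h * q * (s + Q + r + r * Q) * y + (- h * r * Q * q * (1 + q)) * y ^ 2) * ((1 - q) * y)"
      by algebra
    finally show ?thesis using q1 nz by (simp add: y_def)
  qed
  show ?thesis
    by (rule laurent_independent[OF d inj nz(1,3) T entry _ rel]) (use nz Q q1 in auto)
qed

lemma dual_q_Hahn_independent:
  fixes \<theta> \<theta>s \<phi> \<psi> :: "nat \<Rightarrow> 'a::field"
  assumes "dual_q_Hahn d \<theta> \<theta>s \<phi> \<psi>" and d: "d \<ge> 3" and inj: "inj_on \<theta>s {..d}"
    and rel: "\<And>i. i \<le> d \<Longrightarrow>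
      \<alpha> + \<beta> * \<theta>s i + (\<gamma> + \<epsilon> * \<theta>s i) * diagonal_entry d \<theta> \<theta>s \<phi> i = 0"
  shows "\<alpha> = 0 \<and> \<beta> = 0 \<and> \<gamma> = 0 \<and> \<epsilon> = 0"
proof -
  obtain q h k s r where params: "q \<noteq> 0 \<and> h \<noteq> 0 \<and> k \<noteq> 0 \<and> s \<noteq> 0 \<and> r \<noteq> 0 \<and>
        (\<forall>i\<in>{1..d}. q ^ i \<noteq> 1 \<and> r * q ^ i \<noteq> 1 \<and> s * q ^ i / r \<noteq> 1) \<and>
        (\<forall>i\<in>{2..2*d}. s * q ^ i \<noteq> 1) \<and>
        (\<forall>i\<le>d. \<theta> i = \<theta> 0 + h * (1 - q ^ i) * (1 - s * q ^ (i + 1)) * q powi (- int i) \<and>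
               \<theta>s i = \<theta>s 0 + k * (1 - q ^ i) * q powi (- int i)) \<and>
        (\<forall>i\<in>{1..d}.
           \<phi> i = h * k * q powi (1 - 2 * int i) * (1 - q ^ i) *
                 (1 - q powi (int i - int d - 1)) * (1 - r * q ^ i) \<and>
           \<psi> i = h * k * q powi (int d + 2 - 2 * int i) * (1 - q ^ i) *
                 (1 - q powi (int i - int d - 1)) * (s - r * q powi (int i - int d - 1)))"
    using assms(1) unfolding dual_q_Hahn_def by blast
  have nz: "q \<noteq> 0" "h \<noteq> 0" "k \<noteq> 0" "r \<noteq> 0" using params by blast+
  have q2: "q ^ 2 \<noteq> 1" using params d by auto
  show ?thesis
    by (rule dual_q_Hahn_family_independent[OF d inj nz q2 _ _ _ rel, where s = s])
       (use params in blast)+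
qed

lemma affine_q_Krawtchouk_independent:
  fixes \<theta> \<theta>s \<phi> \<psi> :: "nat \<Rightarrow> 'a::field"
  assumes "affine_q_Krawtchouk d \<theta> \<theta>s \<phi> \<psi>" and d: "d \<ge> 3" and inj: "inj_on \<theta>s {..d}"
    and rel: "\<And>i. i \<le> d \<Longrightarrow>
      \<alpha> + \<beta> * \<theta>s i + (\<gamma> + \<epsilon> * \<theta>s i) * diagonal_entry d \<theta> \<theta>s \<phi> i = 0"
  shows "\<alpha> = 0 \<and> \<beta> = 0 \<and> \<gamma> = 0 \<and> \<epsilon> = 0"
proof -
  obtain q h k r where params: "q \<noteq> 0 \<and> h \<noteq> 0 \<and> k \<noteq> 0 \<and> r \<noteq> 0 \<and>
        (\<forall>i\<in>{1..d}. q ^ i \<noteq> 1 \<and> r * q ^ i \<noteq> 1) \<and>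
        (\<forall>i\<le>d. \<theta> i = \<theta> 0 + h * (1 - q ^ i) * q powi (- int i) \<and>
               \<theta>s i = \<theta>s 0 + k * (1 - q ^ i) * q powi (- int i)) \<and>
        (\<forall>i\<in>{1..d}.
           \<phi> i = h * k * q powi (1 - 2 * int i) * (1 - q ^ i) *
                 (1 - q powi (int i - int d - 1)) * (1 - r * q ^ i) \<and>
           \<psi> i = - h * k * r * q powi (1 - int i) * (1 - q ^ i) *
                 (1 - q powi (int i - int d - 1)))"
    using assms(1) unfolding affine_q_Krawtchouk_def by blast
  have nz: "q \<noteq> 0" "h \<noteq> 0" "k \<noteq> 0" "r \<noteq> 0" using params by blast+
  have q2: "q ^ 2 \<noteq> 1" using params d by auto
  have \<theta>: "\<theta> i = \<theta> 0 + h * (1 - q ^ i) * (1 - 0 * q ^ (i + 1)) * q powi (- int i)" if "i \<le> d" for i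
  proof -
    have "\<theta> i = \<theta> 0 + h * (1 - q ^ i) * q powi (- int i)" using params that by blast
    then show ?thesis by (simp only: mult_zero_left diff_zero mult_1_right)
  qed
  have \<theta>s: "\<theta>s i = \<theta>s 0 + k * (1 - q ^ i) * q powi (- int i)" if "i \<le> d" for i
    using params that by blast
  have \<phi>: "\<phi> i = h * k * q powi (1 - 2 * int i) * (1 - q ^ i) *
      (1 - q powi (int i - int d - 1)) * (1 - r * q ^ i)" if "i \<in> {1..d}" for i
    using params that by blast
  show ?thesis by (rule dual_q_Hahn_family_independent[OF d inj nz q2 \<theta> \<theta>s \<phi> rel])
qed

text \<open>The powers of \<open>y\<close> in the denominators cancel completely here. As
  \<open>\<theta>\<close> is affine in \<open>q ^ i\<close>, the quadratic term comes from the split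
  sequence alone, and it is nonzero because \<open>q \<noteq> - 1\<close>.\<close>

lemma quantum_q_Krawtchouk_independent:
  fixes \<theta> \<theta>s \<phi> \<psi> :: "nat \<Rightarrow> 'a::field"
  assumes "quantum_q_Krawtchouk d \<theta> \<theta>s \<phi> \<psi>" and d: "d \<ge> 3" and inj: "inj_on \<theta>s {..d}"
    and rel: "\<And>i. i \<le> d \<Longrightarrow>
      \<alpha> + \<beta> * \<theta>s i + (\<gamma> + \<epsilon> * \<theta>s i) * diagonal_entry d \<theta> \<theta>s \<phi> i = 0"
  shows "\<alpha> = 0 \<and> \<beta> = 0 \<and> \<gamma> = 0 \<and> \<epsilon> = 0"
proof -
  obtain q k s r where nz: "q \<noteq> 0" "k \<noteq> 0" "r \<noteq> 0"
    and ne: "\<forall>i\<in>{1..d}. q ^ i \<noteq> 1 \<and> s * q ^ i / r \<noteq> 1"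
    and \<theta>: "\<And>i. i \<le> d \<Longrightarrow> \<theta> i = \<theta> 0 - s * q * (1 - q ^ i)"
    and \<theta>s: "\<And>i. i \<le> d \<Longrightarrow> \<theta>s i = \<theta>s 0 + k * (1 - q ^ i) * q powi (- int i)"
    and \<phi>: "\<And>i. i \<in> {1..d} \<Longrightarrow> \<phi> i = - r * k * q powi (1 - int i) * (1 - q ^ i) *
       (1 - q powi (int i - int d - 1))"
    using assms(1) unfolding quantum_q_Krawtchouk_def by blast
  have q1: "1 + q \<noteq> 0" "1 - q \<noteq> 0"
    using ne[rule_format, of 2] d one_plus_minus_nonzero[of q] by auto
  define Q where "Q = 1 / q ^ Suc d"
  have Q: "Q \<noteq> 0" using nz by (simp add: Q_def)
  have T: "\<theta>s i = \<theta>s 0 + k * (1 - q ^ i) / q ^ i" if "i \<le> d" for i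
    using \<theta>s[OF that] by (simp add: power_int_minus divide_inverse)
  have P: "\<phi> i = - r * k * q / q ^ i * (1 - q ^ i) * (1 - q ^ i * Q)" if "i \<in> {1..d}" for i
    using nz by (simp add: \<phi>[OF that] power_int_diff Q_def)
  have entry: "diagonal_entry d \<theta> \<theta>s \<phi> i = (\<theta> 0 - s * q)
      + (s * q + r * q * (1 + Q)) * q ^ i + (- r * q * Q * (1 + q)) * (q ^ i) ^ 2"
    if "i \<le> d" for i
  proof -
    define y where "y = q ^ i"
    have y: "y \<noteq> 0" using nz by (simp add: y_def)
    have "diagonal_entry d \<theta> \<theta>s \<phi> i = \<theta> i
      + - r * k * q / y * (1 - y) * (1 - y * Q)
        / (\<theta>s 0 + k * (1 - y) / y - (\<theta>s 0 + k * (1 - y / q) / (y / q)))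
      + - r * k * q / (q * y) * (1 - q * y) * (1 - q * y * Q)
        / (\<theta>s 0 + k * (1 - y) / y - (\<theta>s 0 + k * (1 - q * y) / (q * y)))"
      unfolding y_def
      by (rule diagonal_entry_q[where T = "\<lambda>y. \<theta>s 0 + k * (1 - y) / y"
              and P = "\<lambda>y. - r * k * q / y * (1 - y) * (1 - y * Q)",
              OF that nz(1) T P]) (use nz in \<open>simp_all add: Q_def\<close>)
    also have "\<theta>s 0 + k * (1 - y) / y - (\<theta>s 0 + k * (1 - y / q) / (y / q)) = k * (1 - q) / y"
      using y nz by (simp add: field_simps)
    also have "\<theta>s 0 + k * (1 - y) / y - (\<theta>s 0 + k * (1 - q * y) / (q * y)) = - (k * (1 - q)) / (q * y)"
      using y nz by (simp add: field_simps)
    also have "\<theta> i = \<theta> 0 - s * q * (1 - y)" using \<theta>[OF that] by (simp add: y_def)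
    also have "- r * k * q / y * (1 - y) * (1 - y * Q) / (k * (1 - q) / y)
      = - (r * q * (1 - y) * (1 - y * Q) / (1 - q))"
      using y nz q1 by simp
    also have "- r * k * q / (q * y) * (1 - q * y) * (1 - q * y * Q) / (- (k * (1 - q)) / (q * y))
      = r * q * (1 - q * y) * (1 - q * y * Q) / (1 - q)"
      using y nz q1 by simp
    finally have "diagonal_entry d \<theta> \<theta>s \<phi> i * (1 - q) = (\<theta> 0 - s * q * (1 - y)) * (1 - q)
      - r * q * (1 - y) * (1 - y * Q) + r * q * (1 - q * y) * (1 - q * y * Q)"
      using q1 by (simp add: distrib_right left_diff_distrib)
    also have "\<dots> = ((\<theta> 0 - s * q) + (s * q + r * q * (1 + Q)) * y
      + (- r * q * Q * (1 + q)) * y ^ 2) * (1 - q)"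
      by algebra
    finally show ?thesis using q1 by (simp add: y_def)
  qed
  show ?thesis
    by (rule laurent_independent[OF d inj nz(1,2) T entry _ rel]) (use nz Q q1 in auto)
qed

section \<open>The q-Krawtchouk type\<close>

text \<open>With \<open>\<tau> = q\<^sup>-\<^sup>i + S q\<^sup>i\<^sup>+\<^sup>1\<close> and \<open>Q = q\<^sup>-\<^sup>d\<^sup>-\<^sup>1\<close>, the normalized diagonal entries in the
  \<open>q\<close>-Krawtchouk case are \<open>q ((S + Q) \<tau> - S (1 + Q) (1 + q)) / (\<tau>\<^sup>2 - S (1 + q)\<^sup>2)\<close>. This is \<open>0 / 0\<close>
  at \<open>i = 0\<close> if \<open>S = 1\<close> (take \<open>c = 1\<close>, \<open>e = 0\<close>), and at \<open>i = d\<close> if \<open>S = Q\<^sup>2\<close> (take \<open>c = Q\<close>, \<open>e = d\<close>);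
  both are permitted by the definition.\<close>

lemma degenerate_q_Krawtchouk_relation:
  fixes \<tau> a :: "nat \<Rightarrow> 'a::field"
  assumes inj: "inj_on \<tau> J" and J: "card J \<ge> 3"
    and nz: "q \<noteq> 0" "q ^ 2 \<noteq> 1" "c \<noteq> 0" "Q ^ 2 \<noteq> 1"
    and a: "\<And>i. i \<in> J \<Longrightarrow> a i * (\<tau> i + c * (1 + q)) = q * c * (1 + Q)"
    and e: "\<tau> e = c * (1 + q)" "a e * (1 - q ^ 2) = q * (Q - q)"
    and rel: "\<And>i. i \<in> insert e J \<Longrightarrow> A + B * \<tau> i + (G + E * \<tau> i) * a i = 0"
  shows "A = 0 \<and> B = 0 \<and> G = 0 \<and> E = 0"
proof -
  have card: "card (\<tau> ` J) \<ge> 3" using J inj by (simp add: card_image)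
  have nz': "1 + q \<noteq> 0" "1 - q \<noteq> 0" "1 + Q \<noteq> 0" "1 - Q \<noteq> 0"
    using one_plus_minus_nonzero[of q] one_plus_minus_nonzero[of Q] nz by auto
  \<comment> \<open>Multiplying by \<open>\<tau> i + c * (1 + q)\<close> gives a quadratic with
    three roots. It leaves only multiples of one solution, parametrized by \<open>E\<close>; the
    equation at \<open>e\<close> then excludes \<open>E \<noteq> 0\<close>.\<close>
  have "(A * c * (1 + q) + G * q * c * (1 + Q)) + (A + B * c * (1 + q) + E * q * c * (1 + Q)) * x
      + B * x ^ 2 = 0" if "x \<in> \<tau> ` J" for x
  proof -
    obtain i where i: "i \<in> J" "x = \<tau> i" using \<open>x \<in> \<tau> ` J\<close> by auto
    have "A + B * x + (G + E * x) * a i = 0" "a i * (x + c * (1 + q)) = q * c * (1 + Q)"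
      using rel[of i] a[of i] i by auto
    then show ?thesis by algebra
  qed
  from quadratic_coeffs_zero[OF card this] have B: "B = 0"
    and c1: "A + B * c * (1 + q) + E * q * c * (1 + Q) = 0"
    and c0: "A * c * (1 + q) + G * q * c * (1 + Q) = 0"
    by blast+
  have A: "A = - (E * q * c * (1 + Q))" using c1 B by (simp add: eq_neg_iff_add_eq_0)
  have "c * (q * (1 + Q) * (G - E * c * (1 + q))) = 0" using A c0 by algebra
  then have G: "G = E * c * (1 + q)" using nz nz' by simp
  have "E * (c * q * (1 + q) * (1 - Q)) = 0"
    using rel[of e] e A B G by simp algebra
  then have "E = 0" using nz nz' by simp
  then show ?thesis using A B G by simp
qed

text \<open>Clearing the quadratic denominator gives a cubic in \<tau>. Its coefficients leave two
  linear equations in \<open>G\<close> and \<open>E\<close> with determinant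
  \<open>(1 + q) * (S - 1) * (S - Q ^ 2)\<close>. The excluded values of \<open>S\<close> are those
  for which numerator and denominator of \<open>a i\<close> share a linear factor.\<close>

lemma generic_q_Krawtchouk_relation:
  fixes \<tau> a :: "nat \<Rightarrow> 'a::field"
  assumes inj: "inj_on \<tau> J" and J: "card J \<ge> 4"
    and nz: "q \<noteq> 0" "1 + q \<noteq> 0" "S \<noteq> 0" "S \<noteq> 1" "S \<noteq> Q ^ 2"
    and a: "\<And>i. i \<in> J \<Longrightarrow>
      a i * (\<tau> i ^ 2 - S * (1 + q) ^ 2) = q * ((S + Q) * \<tau> i - S * (1 + Q) * (1 + q))"
    and rel: "\<And>i. i \<in> J \<Longrightarrow> A + B * \<tau> i + (G + E * \<tau> i) * a i = 0"
  shows "A = 0 \<and> B = 0 \<and> G = 0 \<and> E = 0"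
proof -
  have card: "card (\<tau> ` J) \<ge> 4" using J inj by (simp add: card_image)
  have "(- A * S * (1 + q) ^ 2 - G * q * S * (1 + Q) * (1 + q))
      + (- B * S * (1 + q) ^ 2 + G * q * (S + Q) - E * q * S * (1 + Q) * (1 + q)) * x
      + (A + E * q * (S + Q)) * x ^ 2 + B * x ^ 3 = 0" if "x \<in> \<tau> ` J" for x
  proof -
    obtain i where i: "i \<in> J" "x = \<tau> i" using \<open>x \<in> \<tau> ` J\<close> by auto
    have "A + B * x + (G + E * x) * a i = 0"
      "a i * (x ^ 2 - S * (1 + q) ^ 2) = q * ((S + Q) * x - S * (1 + Q) * (1 + q))"
      using rel[of i] a[of i] i by auto
    then show ?thesis by algebra
  qed
  from cubic_coeffs_zero[OF card this] have B: "B = 0" and A: "A + E * q * (S + Q) = 0"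
    and c1: "- B * S * (1 + q) ^ 2 + G * q * (S + Q) - E * q * S * (1 + Q) * (1 + q) = 0"
    and c0: "- A * S * (1 + q) ^ 2 - G * q * S * (1 + Q) * (1 + q) = 0"
    by blast+
  have "S * (1 + q) * q * (G * (1 + Q) - E * (S + Q) * (1 + q)) = 0" using A c0 by algebra
  then have X: "G * (1 + Q) = E * (S + Q) * (1 + q)" using nz by simp
  have "q * (G * (S + Q) - E * S * (1 + Q) * (1 + q)) = 0" using B c1 by algebra
  then have Y: "G * (S + Q) = E * S * (1 + Q) * (1 + q)" using nz by simp
  have "E * ((1 + q) * (S - 1) * (S - Q ^ 2)) = 0" using X Y by algebra
  then have E: "E = 0" using nz by simp
  have "G * (S - 1) = 0" using X Y E by algebra
  then show ?thesis using nz A B E by simp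
qed


lemma q_Krawtchouk_independent:
  fixes \<theta> \<theta>s \<phi> \<psi> :: "nat \<Rightarrow> 'a::field"
  assumes "q_Krawtchouk d \<theta> \<theta>s \<phi> \<psi>" and d: "d \<ge> 3" and inj: "inj_on \<theta>s {..d}"
    and rel: "\<And>i. i \<le> d \<Longrightarrow>
      \<alpha> + \<beta> * \<theta>s i + (\<gamma> + \<epsilon> * \<theta>s i) * diagonal_entry d \<theta> \<theta>s \<phi> i = 0"
  shows "\<alpha> = 0 \<and> \<beta> = 0 \<and> \<gamma> = 0 \<and> \<epsilon> = 0"
proof -
  obtain q h k S where params: "q \<noteq> 0 \<and> h \<noteq> 0 \<and> k \<noteq> 0 \<and> S \<noteq> 0 \<and>
        (\<forall>i\<in>{1..d}. q ^ i \<noteq> 1) \<and>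
        (\<forall>i\<in>{2..2*d}. S * q ^ i \<noteq> 1) \<and>
        (\<forall>i\<le>d. \<theta> i = \<theta> 0 + h * (1 - q ^ i) * q powi (- int i) \<and>
               \<theta>s i = \<theta>s 0 + k * (1 - q ^ i) * (1 - S * q ^ (i + 1)) * q powi (- int i)) \<and>
        (\<forall>i\<in>{1..d}.
           \<phi> i = h * k * q powi (1 - 2 * int i) * (1 - q ^ i) *
                 (1 - q powi (int i - int d - 1)) \<and>
           \<psi> i = h * k * S * q * (1 - q ^ i) * (1 - q powi (int i - int d - 1)))"
    using assms(1) unfolding q_Krawtchouk_def by blast
  have nz: "q \<noteq> 0" "h \<noteq> 0" "k \<noteq> 0" "S \<noteq> 0"
    and ne: "\<And>i. i \<in> {1..d} \<Longrightarrow> q ^ i \<noteq> 1" and neS: "\<And>i. i \<in> {2..2*d} \<Longrightarrow> S * q ^ i \<noteq> 1"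
    and \<theta>: "\<And>i. i \<le> d \<Longrightarrow> \<theta> i = \<theta> 0 + h * (1 - q ^ i) * q powi (- int i)"
    and \<theta>s: "\<And>i. i \<le> d \<Longrightarrow>
      \<theta>s i = \<theta>s 0 + k * (1 - q ^ i) * (1 - S * q ^ (i + 1)) * q powi (- int i)"
    and \<phi>: "\<And>i. i \<in> {1..d} \<Longrightarrow> \<phi> i = h * k * q powi (1 - 2 * int i) * (1 - q ^ i) *
       (1 - q powi (int i - int d - 1))"
    using params by blast+
  have q2: "q ^ 2 \<noteq> 1" using ne[of 2] d by simp
  have q1: "1 + q \<noteq> 0" "1 - q \<noteq> 0" using one_plus_minus_nonzero[OF q2] by auto
  define Q where "Q = 1 / q ^ Suc d"
  have Q: "Q \<noteq> 0" and qdQ: "q * q ^ d * Q = 1" using nz by (simp_all add: Q_def)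
  have T: "\<theta>s i = \<theta>s 0 + k * (1 - q ^ i) * (1 - S * q * q ^ i) / q ^ i" if "i \<le> d" for i
    using \<theta>s[OF that] by (simp add: power_int_minus divide_inverse mult.assoc)
  have P: "\<phi> i = h * k * q / (q ^ i) ^ 2 * (1 - q ^ i) * (1 - q ^ i * Q)"
    if "i \<in> {1..d}" for i
  proof -
    have "q powi (1 - 2 * int i) = q / (q ^ i) ^ 2"
    proof -
      have "q powi (1 - 2 * int i) = q / q powi int (2 * i)"
        using nz by (simp add: power_int_diff)
      also have "q powi int (2 * i) = (q ^ i) ^ 2"
        by (simp only: power_int_of_nat power_even_eq)
      finally show ?thesis .
    qed
    moreover have "q powi (int i - int d - 1) = q ^ i * Q"
      using nz by (simp add: power_int_diff Q_def)
    ultimately show ?thesis by (simp add: \<phi>[OF that])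
  qed
  \<comment> \<open>Up to units, \<open>U i\<close> and \<open>W i\<close> are the differences of
    \<open>\<theta>s i\<close> with its predecessor and its successor. The type excludes
    \<open>S * q ^ j = 1\<close> only for exponents from 2 to \<open>2 * d\<close>, so
    \<open>U 0\<close> vanishes for \<open>S = 1\<close> and \<open>W d\<close> for
    \<open>S = Q ^ 2\<close>. The affected summand of \<open>a\<close> has numerator 0 as well and
    evaluates to 0.\<close>
  define U W \<tau> where "U = (\<lambda>i. 1 - S * (q ^ i) ^ 2)" and "W = (\<lambda>i. 1 - S * q ^ 2 * (q ^ i) ^ 2)"
    and "\<tau> = (\<lambda>i. 1 / q ^ i + S * q * q ^ i)"
  define a where "a = (\<lambda>i. 1 / q ^ i + q * (1 - q ^ i) * (1 - q ^ i * Q) / ((1 - q) * q ^ i * U i)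
    - (1 - q * q ^ i) * (1 - q * q ^ i * Q) / ((1 - q) * q ^ i * W i))"
  have entry: "diagonal_entry d \<theta> \<theta>s \<phi> i = \<theta> 0 - h + h * a i" if "i \<le> d" for i
  proof -
    define y where "y = q ^ i"
    have y: "y \<noteq> 0" using nz by (simp add: y_def)
    have "diagonal_entry d \<theta> \<theta>s \<phi> i = \<theta> i
      + h * k * q / y ^ 2 * (1 - y) * (1 - y * Q)
        / (\<theta>s 0 + k * (1 - y) * (1 - S * q * y) / y
           - (\<theta>s 0 + k * (1 - y / q) * (1 - S * q * (y / q)) / (y / q)))
      + h * k * q / (q * y) ^ 2 * (1 - q * y) * (1 - q * y * Q)
        / (\<theta>s 0 + k * (1 - y) * (1 - S * q * y) / y
           - (\<theta>s 0 + k * (1 - q * y) * (1 - S * q * (q * y)) / (q * y)))"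
      unfolding y_def
      by (rule diagonal_entry_q[where T = "\<lambda>y. \<theta>s 0 + k * (1 - y) * (1 - S * q * y) / y"
              and P = "\<lambda>y. h * k * q / y ^ 2 * (1 - y) * (1 - y * Q)", OF that nz(1) T P])
         (use nz in \<open>simp_all add: Q_def\<close>)
    also have "\<theta>s 0 + k * (1 - y) * (1 - S * q * y) / y
        - (\<theta>s 0 + k * (1 - y / q) * (1 - S * q * (y / q)) / (y / q)) = k * (1 - q) * U i / y"
      using y nz by (simp add: U_def field_simps power2_eq_square flip: y_def)
    also have "\<theta>s 0 + k * (1 - y) * (1 - S * q * y) / y
        - (\<theta>s 0 + k * (1 - q * y) * (1 - S * q * (q * y)) / (q * y)) = - (k * (1 - q) * W i) / (q * y)"
      using y nz by (simp add: W_def field_simps power2_eq_square flip: y_def)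
    also have "\<theta> i = \<theta> 0 + h * (1 - y) / y"
      using \<theta>[OF that] by (simp add: y_def power_int_minus divide_inverse)
    also have "h * k * q / y ^ 2 * (1 - y) * (1 - y * Q) / (k * (1 - q) * U i / y)
      = h * (q * (1 - y) * (1 - y * Q) / ((1 - q) * y * U i))"
      using y nz q1 by (simp add: power2_eq_square mult_ac)
    also have "h * k * q / (q * y) ^ 2 * (1 - q * y) * (1 - q * y * Q) / (- (k * (1 - q) * W i) / (q * y))
      = - (h * ((1 - q * y) * (1 - q * y * Q) / ((1 - q) * y * W i)))"
      using y nz q1 by (simp add: power2_eq_square mult_ac)
    also have "h * (1 - y) / y = h * (1 / y) - h" using y by (simp add: field_simps)
    finally show ?thesis unfolding a_def y_def by (simp add: algebra_simps)
  qed
  have \<theta>s_\<tau>: "\<theta>s i = (\<theta>s 0 - k * (1 + S * q)) + k * \<tau> i" if "i \<le> d" for i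
    using T[OF that] nz by (simp add: \<tau>_def field_simps)
  have inj_\<tau>: "inj_on \<tau> {..d}" 
    using inj \<theta>s_\<tau> unfolding inj_on_def by (metis atMost_iff)
  have UW: "(\<tau> i ^ 2 - S * (1 + q) ^ 2) * (q ^ i) ^ 2 = U i * W i" for i
  proof -
    define y z where "y = q ^ i" and "z = 1 / q ^ i"
    have "y * z = 1" using nz by (simp add: y_def z_def)
    moreover have "\<tau> i = z + S * q * y" by (simp add: \<tau>_def y_def z_def)
    ultimately show ?thesis unfolding U_def W_def y_def[symmetric] by algebra
  qed
  have generic: "a i * (\<tau> i ^ 2 - S * (1 + q) ^ 2) = q * ((S + Q) * \<tau> i - S * (1 + Q) * (1 + q))"
    if nonzero: "U i \<noteq> 0" "W i \<noteq> 0" for i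
  proof -
    \<comment> \<open>With \<open>z\<close> for the inverse of \<open>y\<close>, the identities
      become consequences of \<open>y * z = 1\<close>, free of division.\<close>
    define y z where "y = q ^ i" and "z = 1 / q ^ i"
    have y: "y \<noteq> 0" and yz: "y * z = 1" using nz by (simp_all add: y_def z_def)
    have \<tau>: "\<tau> i = z + S * q * y" by (simp add: \<tau>_def y_def z_def)
    have "a i * ((1 - q) * y * (U i * W i)) = (1 - q) * (U i * W i)
        + q * (1 - y) * (1 - y * Q) * W i - (1 - q * y) * (1 - q * y * Q) * U i"
      unfolding a_def y_def[symmetric] using nonzero y q1 by (simp add: divide_simps) algebra
    also have "\<dots> = (1 - q) * y ^ 2 * q * ((S + Q) * (1 + S * q * y ^ 2) - S * (1 + Q) * (1 + q) * y)"
      unfolding U_def W_def y_def[symmetric] by algebra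
    also have "\<dots> = (1 - q) * y ^ 3 * (q * ((S + Q) * \<tau> i - S * (1 + Q) * (1 + q)))"
      using \<tau> yz by algebra
    finally have "(1 - q) * y ^ 3 * (a i * (\<tau> i ^ 2 - S * (1 + q) ^ 2))
        = (1 - q) * y ^ 3 * (q * ((S + Q) * \<tau> i - S * (1 + Q) * (1 + q)))"
      unfolding UW[symmetric] y_def[symmetric] by algebra
    then show ?thesis using y q1 by simp
  qed
  have U_nz: "U i \<noteq> 0" if "0 < i" "i \<le> d" for i
    using neS[of "2 * i"] that by (auto simp: U_def power_even_eq)
  have W_nz: "W i \<noteq> 0" if "i < d" for i
  proof -
    have "q ^ (2 * Suc i) = q ^ 2 * (q ^ i) ^ 2"
      by (simp only: power_even_eq power_Suc power_mult_distrib)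
    then show ?thesis using neS[of "2 * Suc i"] that by (auto simp: W_def mult.assoc)
  qed
  have U_0: "U 0 \<noteq> 0" if "S \<noteq> 1" using that by (simp add: U_def)
  have W_d: "W d \<noteq> 0" if "S \<noteq> Q ^ 2"
  proof
    assume "W d = 0"
    define y where "y = q ^ d"
    have "q * y * Q = 1" "1 - S * q ^ 2 * y ^ 2 = 0"
      using qdQ \<open>W d = 0\<close> by (simp_all only: y_def W_def)
    then have "S = Q ^ 2" by algebra
    with that show False ..
  qed
  have first: "\<tau> 0 = 1 * (1 + q) \<and> a 0 * (1 - q ^ 2) = q * (Q - q)" if "S = 1"
  proof
    show "\<tau> 0 = 1 * (1 + q)" using that by (simp add: \<tau>_def)
    have clear: "(1 - x / e) * e = e - x" if "e \<noteq> 0" for x e :: 'a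
      using that by (simp add: field_simps)
    have "W 0 = 1 - q ^ 2" using that by (simp add: W_def)
    moreover have "a 0 = 1 - (1 - q * Q) / W 0" using q1 by (simp add: a_def)
    ultimately have "a 0 * (1 - q ^ 2) = (1 - q ^ 2) - (1 - q * Q)"
      using clear[of "1 - q ^ 2" "1 - q * Q"] q2 by simp
    then show "a 0 * (1 - q ^ 2) = q * (Q - q)" by algebra
  qed
  have last: "\<tau> d = Q * (1 + q) \<and> a d * (1 - q ^ 2) = q * (Q - q)" if "S = Q ^ 2"
  proof
    define y where "y = q ^ d"
    have y: "y \<noteq> 0" and yQ: "q * y * Q = 1" using nz qdQ by (simp_all add: y_def)
    have z: "1 / y = q * Q" using y yQ by (simp add: field_simps)
    show "\<tau> d = Q * (1 + q)"
      unfolding \<tau>_def y_def[symmetric] z that using yQ by algebra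
    have U: "U d * q ^ 2 = q ^ 2 - 1" unfolding U_def y_def[symmetric] that using yQ by algebra
    then have "U d \<noteq> 0" using q2 by auto
    then have "a d * ((1 - q) * y * U d) = (1 - q) * U d + q * (1 - y) * (1 - y * Q)"
      unfolding a_def y_def[symmetric] using y q1 yQ by (simp add: divide_simps)
    then have "(1 - q) * (a d * (1 - q ^ 2)) = (1 - q) * (q * (Q - q))" using U yQ by algebra
    then show "a d * (1 - q ^ 2) = q * (Q - q)" using q1 by simp
  qed
  define u where "u = \<theta>s 0 - k * (1 + S * q)"
  define A B G H where "A = \<alpha> + \<beta> * u + (\<gamma> + \<epsilon> * u) * (\<theta> 0 - h)"
    and "B = k * (\<beta> + \<epsilon> * (\<theta> 0 - h))" and "G = (\<gamma> + \<epsilon> * u) * h" and "H = \<epsilon> * k * h"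
  have rel': "A + B * \<tau> i + (G + H * \<tau> i) * a i = 0" if "i \<le> d" for i
  proof -
    have "\<alpha> + \<beta> * (u + k * \<tau> i) + (\<gamma> + \<epsilon> * (u + k * \<tau> i)) * (\<theta> 0 - h + h * a i) = 0"
      using rel[OF that] entry[OF that] \<theta>s_\<tau>[OF that] by (simp add: u_def)
    then show ?thesis unfolding A_def B_def G_def H_def by algebra
  qed
  have "A = 0 \<and> B = 0 \<and> G = 0 \<and> H = 0"
  proof (cases "S = 1")
    case S: True
    \<comment> \<open>\<open>Suc d\<close> lies in \<open>{2..2*d}\<close>, and for
      \<open>S = 1\<close> the type then excludes \<open>q ^ Suc d = 1\<close>.\<close>
    have "Q \<noteq> 1" using neS[of "Suc d"] d S by (auto simp: Q_def)
    show ?thesis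
    proof (cases "Q ^ 2 = 1")
      case True
      then have Q_eq: "Q = - 1" using \<open>Q \<noteq> 1\<close> by (simp add: power2_eq_1_iff)
      \<comment> \<open>Both ends are exceptional here. The generic numerator contains
        \<open>1 + Q = 0\<close> when \<open>S = 1\<close>, so the interior entries vanish. Two
        interior indices determine \<open>A\<close> and \<open>B\<close>, and the ends, with nonzero
        entries, determine \<open>G\<close> and \<open>H\<close>.\<close>
      have inner: "a i = 0" if "0 < i" "i < d" for i
      proof -
        have "U i * W i \<noteq> 0" using U_nz W_nz that by simp
        then have "\<tau> i ^ 2 - S * (1 + q) ^ 2 \<noteq> 0" using UW[of i] by auto
        then show ?thesis using generic[of i] U_nz[of i] W_nz[of i] that by (simp add: Q_eq S)
      qed
      have "A + B * \<tau> 1 = 0" "A + B * \<tau> 2 = 0"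
        using rel'[of 1] rel'[of 2] inner[of 1] inner[of 2] d by simp_all
      moreover have "\<tau> 1 \<noteq> \<tau> 2" using inj_onD[OF inj_\<tau>, of 1 2] d by auto
      ultimately have B: "B = 0" and A: "A = 0" by algebra+
      have "Q - q = - (1 + q)" by (simp add: Q_eq)
      then have "Q - q \<noteq> 0" using q1 by (simp only: neg_equal_0_iff_equal not_False_eq_True)
      then have "a 0 \<noteq> 0" "a d \<noteq> 0" using first[OF S] last nz by (auto simp: S True)
      then have "G + H * \<tau> 0 = 0" "G + H * \<tau> d = 0" using rel'[of 0] rel'[of d] A B by simp_all
      moreover have "\<tau> 0 \<noteq> \<tau> d" using inj_onD[OF inj_\<tau>, of 0 d] d by auto
      ultimately show ?thesis using A B by algebra
    next
      case False
      show ?thesis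
      proof (rule degenerate_q_Krawtchouk_relation[where J = "{1..d}" and e = 0 and c = 1])
        show "a i * (\<tau> i + 1 * (1 + q)) = q * 1 * (1 + Q)" if i: "i \<in> {1..d}" for i
        proof -
          have "W i \<noteq> 0" using W_nz[of i] W_d False S i by (cases "i = d") auto
          \<comment> \<open>The common factor of numerator and denominator for \<open>S = 1\<close>.
            It is \<open>\<tau> i - \<tau> 0\<close>, hence nonzero away from the exceptional
            end.\<close>
          then have "(\<tau> i - (1 + q)) * (a i * (\<tau> i + 1 * (1 + q))) = (\<tau> i - (1 + q)) * (q * 1 * (1 + Q))"
            using generic[of i] U_nz[of i] i S by simp algebra
          moreover have "\<tau> i \<noteq> 1 + q" using inj_onD[OF inj_\<tau>, of 0 i] first[OF S] i by auto
          ultimately show ?thesis by simp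
        qed
      qed (use d nz q2 False first[OF S] rel' inj_\<tau> in \<open>auto intro: inj_on_subset\<close>)
    qed
  next
    case S: False
    show ?thesis
    proof (cases "S = Q ^ 2")
      case True
      show ?thesis
      proof (rule degenerate_q_Krawtchouk_relation[where J = "{..<d}" and e = d and c = Q])
        show "a i * (\<tau> i + Q * (1 + q)) = q * Q * (1 + Q)" if i: "i \<in> {..<d}" for i
        proof -
          have "U i \<noteq> 0" using U_nz[of i] U_0[OF S] i by (cases "i = 0") auto
          \<comment> \<open>The same cancellation at the other end, where
            \<open>\<tau> d = Q * (1 + q)\<close>.\<close>
          then have "(\<tau> i - Q * (1 + q)) * (a i * (\<tau> i + Q * (1 + q)))
              = (\<tau> i - Q * (1 + q)) * (q * Q * (1 + Q))"
            using generic[of i] W_nz[of i] i True by simp algebra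
          moreover have "\<tau> i \<noteq> Q * (1 + q)" using inj_onD[OF inj_\<tau>, of i d] last[OF True] i by auto
          ultimately show ?thesis by simp
        qed
      qed (use d nz q2 Q True S last[OF True] rel' inj_\<tau> in \<open>auto intro: inj_on_subset\<close>)
    next
      case False
      show ?thesis
      proof (rule generic_q_Krawtchouk_relation[where J = "{..d}"])
        show "a i * (\<tau> i ^ 2 - S * (1 + q) ^ 2) = q * ((S + Q) * \<tau> i - S * (1 + Q) * (1 + q))"
          if "i \<in> {..d}" for i
          using that U_nz[of i] U_0[OF S] W_nz[of i] W_d[OF False]
          by (intro generic; cases "i = 0"; cases "i = d"; simp)
      qed (use d nz q1 False S rel' inj_\<tau> in auto)
    qed
  qed
  then show ?thesis using nz by (auto simp: A_def B_def G_def H_def)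
qed

section \<open>Case distinction over the six types\<close>

theorem theorem9p2:
  fixes scale :: "'a::alg_closed_field \<Rightarrow> 'v::ab_group_add \<Rightarrow> 'v"
    and d :: nat
    and A As :: "'v \<Rightarrow> 'v" and E Es :: "nat \<Rightarrow> 'v \<Rightarrow> 'v"
    and \<theta> \<theta>s \<phi> \<psi> :: "nat \<Rightarrow> 'a"
  assumes "vector_space scale"
    and "vector_space.dim scale (UNIV :: 'v set) = d + 1"
    and "d \<ge> 3"
    and "leonard_system scale d A E As Es"
    and "parameter_array scale d A E As Es \<theta> \<theta>s \<phi> \<psi>"
    and "dual_q_Hahn d \<theta> \<theta>s \<phi> \<psi> \<or> quantum_q_Krawtchouk d \<theta> \<theta>s \<phi> \<psi> \<or>
         q_Krawtchouk d \<theta> \<theta>s \<phi> \<psi> \<or> affine_q_Krawtchouk d \<theta> \<theta>s \<phi> \<psi> \<or>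
         dual_Hahn d \<theta> \<theta>s \<phi> \<psi> \<or> orphan d \<theta> \<theta>s \<phi> \<psi>"
  shows "zero_diagonal_space scale d A As Es = {\<lambda>_. 0}"
proof (rule zero_diagonal_space_trivial[OF assms(1,4,5)])
  fix \<alpha> \<beta> \<gamma> \<epsilon> :: 'a
  assume inj: "inj_on \<theta>s {..d}"
    and rel: "\<And>i. i \<le> d \<Longrightarrow>
      \<alpha> + \<beta> * \<theta>s i + (\<gamma> + \<epsilon> * \<theta>s i) * diagonal_entry d \<theta> \<theta>s \<phi> i = 0"
  show "\<alpha> = 0 \<and> \<beta> = 0 \<and> \<gamma> = 0 \<and> \<epsilon> = 0"
    using assms(6) dual_q_Hahn_independent[OF _ assms(3) inj rel]
      quantum_q_Krawtchouk_independent[OF _ assms(3) inj rel]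
      q_Krawtchouk_independent[OF _ assms(3) inj rel]
      affine_q_Krawtchouk_independent[OF _ assms(3) inj rel]
      dual_Hahn_independent[OF _ assms(3) inj rel] orphan_independent[OF _ rel]
    by blast
qed

end
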